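(* Consider the flow network $\dot x=B\lambda+P_0d$, where $B$ is the incidence matrix of a graph $G$ and $d=\Gamma^dw$ is a disturbance generated by the exosystem $\dot w=S^dw$ (so that $\dot x=B\lambda+Pw$ with $P=P_0\Gamma^d$). Assume that $G$ is connected and that $S^d_j$ is skew-symmetric for each $j=1,2,\dots,q$. Then the dynamic feedback controller $$\dot\eta=\overline S\,\eta-\overline H^TB^Tx,\qquad \lambda=\overline H\,\eta-B^Tx$$ guarantees boundedness of the state of the closed-loop system and asymptotic convergence of $x(t)$ to $$\mathbf 1_n\Big(c'+\int_0^t\frac{\mathbf 1_n^TPw(s)}{n}\,ds\Big)$$ for some constant $c'$.
   Context: $G=(V,E)$ is an undirected graph with $|V|=n$ nodes and $|E|=m$ edges; the two ends of each edge are labeled, one with $+$ and one with $-$. The incidence matrix $B\in\mathbb R^{n\times m}$ has entries $b_{ik}=+1$ if node $i$ is the positive end of edge $k$, $-1$ if it is the negative end, and $0$ otherwise. $\mathbf 1_n$ is the all-ones vector in $\mathbb R^n$. $x\in\mathbb R^n$ is the vector of quantities stored at the nodes and $\lambda\in\mathbb R^m$ the vector of edge flows (the control). Exosystem: for $j=1,\dots,q$ ($q\le n$), $\dot w_j=S^d_jw_j$, $d_j=\Gamma^d_jw_j\in\mathbb R$, $w_j\in\mathbb R^{p_j}$. Stack $w=(w_1^T,\dots,w_q^T)^T\in\mathbb R^p$ with $p=\sum_jp_j$, $S^d=\mathrm{block.diag}(S^d_1,\dots,S^d_q)$, $\Gamma^d=\mathrm{block.diag}(\Gamma^d_1,\dots,\Gamma^d_q)$.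 $P_0\in\mathbb R^{n\times q}$ is a given matrix and $P=P_0\Gamma^d\in\mathbb R^{n\times p}$. Conventions: when $G$ is connected, $B$ has rank $n-1$, and the edges are labeled so that the first $n-1$ columns of $B$, forming the matrix $B_a$, are linearly independent. Put $Y=\frac1n\mathbf 1_n\mathbf 1_n^T-I_n$ and $$M=\begin{pmatrix}(B_a^TB_a)^{-1}B_a^TYP\\ \mathbf 0\end{pmatrix}\in\mathbb R^{m\times p}$$ (the last $m-n+1$ rows are zero). $H_k\in\mathbb R^{1\times p}$ is the $k$-th row of $M$, $k=1,\dots,n-1$. Controller: $\eta=(\eta_1^T,\dots,\eta_{n-1}^T)^T$ with $\eta_k\in\mathbb R^p$; $\overline S=I_{n-1}\otimes S^d$; $\overline H=\begin{pmatrix}\overline H_1\\ \mathbf 0\end{pmatrix}\in\mathbb R^{m\times(n-1)p}$ with $\overline H_1=\mathrm{block.diag}(H_1,\dots,H_{n-1})$.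
   Formalization: Boundedness of x is claimed only when the integral of 1^T P w/n is bounded (it fails e.g. for S^d=0, w=1, P_0=e_1, Γ^d=1, where 1^T x grows like t); boundedness of η and of x minus 1_n times that integral is proved without this condition. *)

theory Defs
  imports
    "HOL-Analysis.Analysis"
    "Graph_Theory.Pair_Digraph"
    "Graph_Theory.Digraph_Component"
    "Jordan_Normal_Form.Gauss_Jordan_Elimination"
    "Jordan_Normal_Form.DL_Rank"
begin

text \<open>
  In this theory the infixes for component access and scalar product refer to the
  dynamically sized vectors of Jordan_Normal_Form. Nodes, edges and blocks are numbered
  from 0.
\<close>

no_notation vec_nth (infixl \<open>$\<close> 90)
no_notation inner (infix \<open>\<bullet>\<close> 70)

text \<open>
  A simple undirected graph is a finite loop-free digraph with a symmetric arc set
  (locale pair_graph). Edge \<open>k < m\<close> has positive end \<open>pos k\<close> and negative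
  end \<open>neg k\<close>; each undirected edge is numbered exactly once.
\<close>

definition edge_labelling ::
    "'a pair_pre_digraph \<Rightarrow> nat \<Rightarrow> (nat \<Rightarrow> 'a) \<Rightarrow> (nat \<Rightarrow> 'a) \<Rightarrow> bool" where
  "edge_labelling G m pos neg \<longleftrightarrow>
     bij_betw (\<lambda>k. {pos k, neg k}) {0..<m} {{u, v} | u v. (u, v) \<in> parcs G}"

definition incidence_mat ::
    "nat \<Rightarrow> nat \<Rightarrow> (nat \<Rightarrow> nat) \<Rightarrow> (nat \<Rightarrow> nat) \<Rightarrow> real mat" where
  "incidence_mat n m pos neg =
     mat n m (\<lambda>(i, k). if i = pos k then 1 else if i = neg k then - 1 else 0)"

definition first_cols :: "nat \<Rightarrow> real mat \<Rightarrow> real mat" where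
  "first_cols r A = mat_of_cols (dim_row A) (take r (cols A))"

definition lin_indpt_cols :: "real mat \<Rightarrow> bool" where
  "lin_indpt_cols A \<longleftrightarrow> distinct (cols A) \<and>
     \<not> module.lin_dep class_ring (module_vec TYPE(real) (dim_row A)) (set (cols A))"

definition ones :: "nat \<Rightarrow> real vec" where
  "ones n = vec n (\<lambda>_. 1)"

definition kronecker_mat :: "real mat \<Rightarrow> real mat \<Rightarrow> real mat" where
  "kronecker_mat A B = mat (dim_row A * dim_row B) (dim_col A * dim_col B)
     (\<lambda>(i, j). A $$ (i div dim_row B, j div dim_col B) * B $$ (i mod dim_row B, j mod dim_col B))"

definition Y_mat :: "nat \<Rightarrow> real mat" where
  "Y_mat n = (1 / real n) \<cdot>\<^sub>m (mat_of_cols n [ones n] * mat_of_row (ones n)) - 1\<^sub>m n"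

text \<open>
  For a connected graph the columns of \<open>Ba\<close> below are linearly independent, so that
  its Gram matrix is invertible and the option value is not \<open>None\<close>.
\<close>

definition M_mat :: "nat \<Rightarrow> nat \<Rightarrow> real mat \<Rightarrow> real mat \<Rightarrow> real mat" where
  "M_mat n m B P = (let Ba = first_cols (n - 1) B in
     (the (mat_inverse (Ba\<^sup>T * Ba)) * Ba\<^sup>T * Y_mat n * P)
       @\<^sub>r 0\<^sub>m (m - (n - 1)) (dim_col P))"

definition S_bar :: "nat \<Rightarrow> real mat \<Rightarrow> real mat" where
  "S_bar n Sd = kronecker_mat (1\<^sub>m (n - 1)) Sd"

definition H_bar :: "nat \<Rightarrow> nat \<Rightarrow> real mat \<Rightarrow> real mat" where
  "H_bar n m M =
     diag_block_mat (map (\<lambda>k. mat_of_row (row M k)) [0..<n - 1])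
       @\<^sub>r 0\<^sub>m (m - (n - 1)) ((n - 1) * dim_col M)"

definition solves_ode ::
    "nat \<Rightarrow> (real \<Rightarrow> real vec) \<Rightarrow> (real \<Rightarrow> real vec) \<Rightarrow> bool" where
  "solves_ode k z f \<longleftrightarrow> (\<forall>t\<ge>0. z t \<in> carrier_vec k \<and>
     (\<forall>i<k. ((\<lambda>s. z s $ i) has_real_derivative f t $ i) (at t within {0..})))"

definition bounded_traj :: "nat \<Rightarrow> (real \<Rightarrow> real vec) \<Rightarrow> bool" where
  "bounded_traj k z \<longleftrightarrow> (\<forall>i<k. bounded ((\<lambda>t. z t $ i) ` {0..}))"

definition converges_to_traj ::
    "nat \<Rightarrow> (real \<Rightarrow> real vec) \<Rightarrow> (real \<Rightarrow> real vec) \<Rightarrow> bool" where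
  "converges_to_traj k z y \<longleftrightarrow> (\<forall>i<k. ((\<lambda>t. z t $ i - y t $ i) \<longlongrightarrow> 0) at_top)"

text \<open>
  \<open>drift\<close> is the scalar integral in the limit profile. It can be unbounded:
  if \<open>Sd\<close> is singular, \<open>w\<close> may have a constant component with nonzero
  total inflow. Since the columns of an incidence matrix sum to zero, \<open>x\<close> is then
  unbounded for every choice of edge flows, and only its deviation from the drift can be
  bounded.
\<close>

definition drift :: "nat \<Rightarrow> real mat \<Rightarrow> (real \<Rightarrow> real vec) \<Rightarrow> real \<Rightarrow> real" where
  "drift n P w t = integral {0..t} (\<lambda>s. (ones n \<bullet> (P *\<^sub>v w s)) / real n)"

end

theory Submission
  imports Defs
begin

text \<open>
  Since \<open>B *\<^sub>v (M *\<^sub>v w) + P *\<^sub>v w\<close> is the average of \<open>P *\<^sub>v w\<close> times the all-ones vector and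
  \<open>\<eta>\<^sub>k = w\<close> for all \<open>k\<close> makes the internal model reproduce \<open>M *\<^sub>v w\<close>, the deviations \<open>\<xi>\<close> of \<open>x\<close> from
  the drift and \<open>\<zeta>\<close> of \<open>\<eta>\<close> from the stacked copies of \<open>w\<close> satisfy the autonomous system
  \<open>\<xi>' = F \<zeta> - B B\<^sup>T \<xi>\<close>, \<open>\<zeta>' = S \<zeta> - F\<^sup>T \<xi>\<close> with \<open>F = B H\<close> and \<open>S\<close> skew. Its energy
  \<open>\<xi> \<bullet> \<xi> + \<zeta> \<bullet> \<zeta>\<close> decreases at the rate \<open>2 (B\<^sup>T \<xi>) \<bullet> (B\<^sup>T \<xi>)\<close>, so both deviations are bounded and
  \<open>B\<^sup>T \<xi>\<close> tends to zero by Barbalat's lemma. As the graph is connected and the sum of the entries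
  of \<open>\<xi>\<close> is conserved, every entry of \<open>\<xi>\<close> tends to their common average.
\<close>

subsection \<open>Trajectories on the half line\<close>

lemma solves_odeD:
  assumes "solves_ode k z f" "t \<ge> 0"
  shows "z t \<in> carrier_vec k"
    and "i < k \<Longrightarrow> ((\<lambda>s. z s $ i) has_real_derivative f t $ i) (at t within {0..})"
  using assms unfolding solves_ode_def by auto

lemma solves_ode_cong:
  assumes "solves_ode k z f" "\<And>t. t \<ge> 0 \<Longrightarrow> f t = g t"
  shows "solves_ode k z g"
  using assms unfolding solves_ode_def by simp

text \<open>Index identities for trajectories are known only at nonnegative times, where the carrier
  is fixed; a derivative within the half line sees nothing else and can be moved along them.\<close>

lemma has_real_derivative_cong_half_line:
  assumes "(f has_real_derivative D) (at t within {0..})" "t \<ge> 0"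
    and "\<And>s. s \<ge> 0 \<Longrightarrow> g s = f s"
  shows "(g has_real_derivative D) (at t within {0..})"
  using assms by (intro has_field_derivative_transform_within[OF assms(1), of 1]) auto

lemma solves_ode_minus:
  assumes "solves_ode k z f" "solves_ode k y g"
    and "\<And>t. t \<ge> 0 \<Longrightarrow> g t \<in> carrier_vec k"
  shows "solves_ode k (\<lambda>t. z t - y t) (\<lambda>t. f t - g t)"
  unfolding solves_ode_def
proof (intro allI impI conjI)
  fix t :: real and i assume t: "t \<ge> 0"
  show "z t - y t \<in> carrier_vec k"
    using solves_odeD(1)[OF assms(1) t] solves_odeD(1)[OF assms(2) t] by simp
  assume i: "i < k"
  have "((\<lambda>s. z s $ i - y s $ i) has_real_derivative f t $ i - g t $ i) (at t within {0..})"
    by (intro derivative_intros solves_odeD(2)[OF assms(1)] solves_odeD(2)[OF assms(2)] t i)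
  moreover have "(z s - y s) $ i = z s $ i - y s $ i" if "s \<ge> 0" for s
    using i solves_odeD(1)[OF assms(2) that] by simp
  ultimately show "((\<lambda>s. (z s - y s) $ i) has_real_derivative (f t - g t) $ i) (at t within {0..})"
    using i assms(3)[OF t] has_real_derivative_cong_half_line[OF _ t] by simp
qed

lemma solves_ode_mult_mat_vec:
  assumes z: "solves_ode k z f" and A: "A \<in> carrier_mat r k"
    and f: "\<And>t. t \<ge> 0 \<Longrightarrow> f t \<in> carrier_vec k"
  shows "solves_ode r (\<lambda>t. A *\<^sub>v z t) (\<lambda>t. A *\<^sub>v f t)"
  unfolding solves_ode_def
proof (intro allI impI conjI)
  fix t :: real and i assume t: "t \<ge> 0"
  show "A *\<^sub>v z t \<in> carrier_vec r"
    using A solves_odeD(1)[OF z t] by simp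
  assume i: "i < r"
  have *: "(A *\<^sub>v v) $ i = (\<Sum>j<k. A $$ (i, j) * v $ j)" if "v \<in> carrier_vec k" for v
    using i A that by (simp add: scalar_prod_def atLeast0LessThan)
  have "((\<lambda>s. \<Sum>j<k. A $$ (i, j) * z s $ j) has_real_derivative
      (\<Sum>j<k. A $$ (i, j) * f t $ j)) (at t within {0..})"
    by (intro DERIV_sum DERIV_cmult solves_odeD(2)[OF z t]) simp
  then show "((\<lambda>s. (A *\<^sub>v z s) $ i) has_real_derivative (A *\<^sub>v f t) $ i) (at t within {0..})"
    unfolding *[OF f[OF t]]
    by (rule has_real_derivative_cong_half_line[OF _ t]) (rule *[OF solves_odeD(1)[OF z]])
qed

lemma solves_ode_scalar_prod:
  assumes z: "solves_ode k z f" and y: "solves_ode k y g" and t: "t \<ge> 0"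
    and f: "f t \<in> carrier_vec k" and g: "g t \<in> carrier_vec k"
  shows "((\<lambda>s. z s \<bullet> y s) has_real_derivative f t \<bullet> y t + z t \<bullet> g t) (at t within {0..})"
proof -
  have "((\<lambda>s. \<Sum>i<k. z s $ i * y s $ i) has_real_derivative
      (\<Sum>i<k. f t $ i * y t $ i + z t $ i * g t $ i)) (at t within {0..})"
  proof (intro DERIV_sum)
    fix i assume "i \<in> {..<k}"
    then show "((\<lambda>s. z s $ i * y s $ i) has_real_derivative
        f t $ i * y t $ i + z t $ i * g t $ i) (at t within {0..})"
      using DERIV_mult[OF solves_odeD(2)[OF z t] solves_odeD(2)[OF y t], of i i]
      by (simp add: mult.commute)
  qed
  moreover have "(\<Sum>i<k. f t $ i * y t $ i + z t $ i * g t $ i) = f t \<bullet> y t + z t \<bullet> g t"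
    using solves_odeD(1)[OF y t] g by (simp add: scalar_prod_def sum.distrib atLeast0LessThan)
  moreover have "z s \<bullet> y s = (\<Sum>i<k. z s $ i * y s $ i)" if "s \<ge> 0" for s
    using solves_odeD(1)[OF y that] by (simp add: scalar_prod_def atLeast0LessThan)
  ultimately show ?thesis
    using has_real_derivative_cong_half_line[OF _ t] by simp
qed

section \<open>Mean value arguments on the half line and Barbalat's lemma\<close>

lemma mean_value_half_line:
  fixes f f' :: "real \<Rightarrow> real"
  assumes deriv: "\<And>t. t \<ge> 0 \<Longrightarrow> (f has_real_derivative f' t) (at t within {0..})"
    and ab: "0 \<le> a" "a < b"
  shows "\<exists>\<xi>. a < \<xi> \<and> \<xi> < b \<and> f b - f a = (b - a) * f' \<xi>"
proof -
  have "(f has_derivative (\<lambda>h. f' t * h)) (at t within {a..b})" if "a \<le> t" "t \<le> b" for t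
    using deriv[of t] that ab unfolding has_field_derivative_def
    by (auto intro: has_derivative_subset)
  from mvt_simple[OF ab(2) this] show ?thesis
    by (auto simp: mult.commute)
qed

lemma nonincreasing_half_line:
  fixes V V' :: "real \<Rightarrow> real"
  assumes "\<And>t. t \<ge> 0 \<Longrightarrow> (V has_real_derivative V' t) (at t within {0..})"
    and "\<And>t. t \<ge> 0 \<Longrightarrow> V' t \<le> 0"
    and "0 \<le> s" "s \<le> t"
  shows "V t \<le> V s"
proof (cases "s = t")
  case False
  then obtain \<xi> where "s < \<xi>" "V t - V s = (t - s) * V' \<xi>"
    using mean_value_half_line[OF assms(1), of s t] assms(3,4) by auto
  then show ?thesis
    using assms(2)[of \<xi>] assms(3,4) mult_nonneg_nonpos[of "t - s" "V' \<xi>"] by simp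
qed simp

text \<open>\<open>V\<close> decreases to its infimum, so over a late window of fixed length it
  drops very little and \<open>g\<close> is small somewhere in that window. The bound on
  \<open>h\<close> makes \<open>g\<close> Lipschitz, so \<open>g\<close> is small at the start of
  the window too.\<close>

lemma barbalat:
  fixes V g h :: "real \<Rightarrow> real"
  assumes V: "\<And>t. t \<ge> 0 \<Longrightarrow> (V has_real_derivative - g t) (at t within {0..})"
    and g: "\<And>t. t \<ge> 0 \<Longrightarrow> (g has_real_derivative h t) (at t within {0..})"
    and h: "\<And>t. t \<ge> 0 \<Longrightarrow> \<bar>h t\<bar> \<le> L"
    and V_nonneg: "\<And>t. t \<ge> 0 \<Longrightarrow> V t \<ge> 0" and g_nonneg: "\<And>t. t \<ge> 0 \<Longrightarrow> g t \<ge> 0"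
  shows "(g \<longlongrightarrow> 0) at_top"
proof -
  define l where "l = Inf (V ` {0..})"
  have anti: "V t \<le> V s" if "0 \<le> s" "s \<le> t" for s t
    using nonincreasing_half_line[OF V] g_nonneg that by simp
  have bdd: "bdd_below (V ` {0..})"
    using V_nonneg by (auto intro!: bdd_belowI)
  have l_le: "l \<le> V t" if "t \<ge> 0" for t
    unfolding l_def using that bdd by (auto intro: cInf_lower)
  have L: "L \<ge> 0" using h[of 0] by simp
  show ?thesis
  proof (rule tendstoI)
    fix e :: real assume e: "e > 0"
    \<comment> \<open>Over a time \<open>\<delta>\<close> the function \<open>g\<close> changes by
      at most \<open>L * \<delta> < e / 2\<close>; the \<open>+ 1\<close> avoids division by zero
      when \<open>L = 0\<close>.\<close>
    define \<delta> where "\<delta> = e / (2 * (L + 1))"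
    have \<delta>: "\<delta> > 0" "L * \<delta> < e / 2" using e L by (auto simp: \<delta>_def field_simps)
    \<comment> \<open>From \<open>T\<close> on, \<open>V\<close> can lose less than
      \<open>\<delta> * (e / 2)\<close>, so \<open>g\<close> falls below \<open>e / 2\<close>
      somewhere in each later window of length \<open>\<delta>\<close>.\<close>
    obtain T where T: "T \<ge> 0" "V T < l + \<delta> * (e / 2)"
      using cInf_lessD[of "V ` {0..}" "l + \<delta> * (e / 2)"] e \<delta> by (auto simp: l_def)
    have "dist (g t) 0 < e" if t: "t \<ge> T" for t
    proof -
      obtain \<xi> where \<xi>: "t < \<xi>" "\<xi> < t + \<delta>" "V (t + \<delta>) - V t = \<delta> * - g \<xi>"
        using mean_value_half_line[OF V, of t "t + \<delta>"] T t \<delta>(1) by auto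
      have "\<delta> * g \<xi> < \<delta> * (e / 2)"
        using \<xi>(3) anti[of T t] l_le[of "t + \<delta>"] T t \<delta>(1) by linarith
      then have "g \<xi> < e / 2" using \<delta> by simp
      obtain \<zeta> where \<zeta>: "t < \<zeta>" "g \<xi> - g t = (\<xi> - t) * h \<zeta>"
        using mean_value_half_line[OF g, of t \<xi>] T t \<xi> by auto
      have "\<bar>(\<xi> - t) * h \<zeta>\<bar> \<le> \<delta> * L"
        unfolding abs_mult using \<xi> \<zeta> h[of \<zeta>] T t L by (intro mult_mono) auto
      then show ?thesis
        using \<open>g \<xi> < e / 2\<close> \<zeta>(2) \<delta>(2) g_nonneg[of t] T t by (simp add: mult.commute dist_real_def)
    qed
    then show "\<forall>\<^sub>F t in at_top. dist (g t) 0 < e"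
      by (auto simp: eventually_at_top_linorder)
  qed
qed

section \<open>Bounds for scalar products and bounded trajectories\<close>

lemma scalar_prod_self_nonneg: "v \<bullet> v \<ge> (0::real)"
  by (auto simp: scalar_prod_def intro: sum_nonneg)

lemma square_le_scalar_prod_self:
  fixes v :: "real vec"
  assumes "i < dim_vec v"
  shows "(v $ i)\<^sup>2 \<le> v \<bullet> v"
  unfolding scalar_prod_def power2_eq_square using assms
  by (intro member_le_sum[where f = "\<lambda>i. v $ i * v $ i"]) auto

lemma bounded_traj_iff:
  "bounded_traj k z \<longleftrightarrow> (\<forall>i<k. \<exists>C. \<forall>t\<ge>0. \<bar>z t $ i\<bar> \<le> C)"
  by (simp add: bounded_traj_def bounded_iff image_iff Bex_def) blast

text \<open>Turns an energy bound into boundedness: no entry exceeds the Euclidean norm.\<close>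

lemma bounded_trajI:
  assumes "\<And>t. t \<ge> 0 \<Longrightarrow> z t \<in> carrier_vec k" "\<And>t. t \<ge> 0 \<Longrightarrow> z t \<bullet> z t \<le> C"
  shows "bounded_traj k z"
  unfolding bounded_traj_iff
proof (intro allI impI exI)
  fix i and t :: real assume i: "i < k" and t: "t \<ge> 0"
  have "(z t $ i)\<^sup>2 \<le> C"
    using square_le_scalar_prod_self[of i "z t"] assms[OF t] i by auto
  then show "\<bar>z t $ i\<bar> \<le> sqrt C" using real_le_rsqrt by fastforce
qed

lemma bounded_traj_cong:
  assumes "bounded_traj k z" "\<And>t i. \<lbrakk>t \<ge> 0; i < k\<rbrakk> \<Longrightarrow> z t $ i = y t $ i"
  shows "bounded_traj k y"
  using assms by (simp add: bounded_traj_iff)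

lemma bounded_traj_add:
  assumes "bounded_traj k z" "bounded_traj k y" "\<And>t. t \<ge> 0 \<Longrightarrow> y t \<in> carrier_vec k"
  shows "bounded_traj k (\<lambda>t. z t + y t)"
  unfolding bounded_traj_iff
proof (intro allI impI)
  fix i assume i: "i < k"
  then obtain C D where "\<forall>t\<ge>0. \<bar>z t $ i\<bar> \<le> C" "\<forall>t\<ge>0. \<bar>y t $ i\<bar> \<le> D"
    using assms(1,2) unfolding bounded_traj_iff by blast
  then have "\<bar>(z t + y t) $ i\<bar> \<le> C + D" if "t \<ge> 0" for t
    using assms(3)[OF that] i abs_triangle_ineq[of "z t $ i" "y t $ i"] that by fastforce
  then show "\<exists>C. \<forall>t\<ge>0. \<bar>(z t + y t) $ i\<bar> \<le> C" by blast
qed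

lemma bounded_traj_minus:
  assumes "bounded_traj k z" "bounded_traj k y" "\<And>t. t \<ge> 0 \<Longrightarrow> y t \<in> carrier_vec k"
  shows "bounded_traj k (\<lambda>t. z t - y t)"
proof -
  have "(- y t) $ i = - (y t $ i)" if "t \<ge> 0" "i < k" for t i
    using assms(3)[OF that(1)] that(2) by simp
  then have "bounded_traj k (\<lambda>t. - y t)"
    using assms(2) unfolding bounded_traj_iff by simp
  then have "bounded_traj k (\<lambda>t. z t + - y t)"
    using bounded_traj_add[OF assms(1)] assms(3) by simp
  then show ?thesis
  proof (rule bounded_traj_cong)
    show "(z t + - y t) $ i = (z t - y t) $ i" if "t \<ge> 0" "i < k" for t i
      using assms(3)[OF that(1)] that(2) by simp
  qed
qed

lemma bounded_traj_scalar_prod: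
  assumes z: "bounded_traj k z" and y: "bounded_traj k y" and "\<And>t. t \<ge> 0 \<Longrightarrow> y t \<in> carrier_vec k"
  shows "\<exists>C. \<forall>t\<ge>0. \<bar>z t \<bullet> y t\<bar> \<le> C"
proof -
  obtain C where C: "\<And>i t. \<lbrakk>i < k; t \<ge> 0\<rbrakk> \<Longrightarrow> \<bar>z t $ i\<bar> \<le> C i"
    using z unfolding bounded_traj_iff by metis
  obtain D where D: "\<And>i t. \<lbrakk>i < k; t \<ge> 0\<rbrakk> \<Longrightarrow> \<bar>y t $ i\<bar> \<le> D i"
    using y unfolding bounded_traj_iff by metis
  have "\<bar>z t \<bullet> y t\<bar> \<le> (\<Sum>i<k. C i * D i)" if t: "t \<ge> 0" for t
  proof -
    have "\<bar>z t \<bullet> y t\<bar> \<le> (\<Sum>i<k. \<bar>z t $ i * y t $ i\<bar>)"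
      using assms(3)[OF t] by (simp add: scalar_prod_def atLeast0LessThan)
    also have "\<dots> \<le> (\<Sum>i<k. C i * D i)"
      \<comment> \<open>Monotonicity of products needs \<open>0 \<le> C i\<close>, which follows
        from \<open>0 \<le> \<bar>z t $ i\<bar> \<le> C i\<close>.\<close>
      unfolding abs_mult by (intro sum_mono mult_mono C D order_trans[OF abs_ge_zero C]) (use t in auto)
    finally show ?thesis .
  qed
  then show ?thesis by blast
qed

lemma bounded_traj_mult_mat_vec:
  assumes z: "bounded_traj k z" and "\<And>t. t \<ge> 0 \<Longrightarrow> z t \<in> carrier_vec k" and A: "A \<in> carrier_mat r k"
  shows "bounded_traj r (\<lambda>t. A *\<^sub>v z t)"
  unfolding bounded_traj_iff
proof (intro allI impI)
  fix i assume i: "i < r"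
  have "bounded_traj k (\<lambda>_. row A i)" by (auto simp: bounded_traj_iff)
  from bounded_traj_scalar_prod[OF this z assms(2)]
  show "\<exists>C. \<forall>t\<ge>0. \<bar>(A *\<^sub>v z t) $ i\<bar> \<le> C"
    using A i by auto
qed

subsection \<open>Energy dissipation\<close>

text \<open>Moving \<open>S\<close> to the other factor flips the sign, so the number equals its own
  negative.\<close>

lemma skew_quadratic_form:
  fixes S :: "real mat"
  assumes S: "S \<in> carrier_mat k k" and "S\<^sup>T = - S" and v: "v \<in> carrier_vec k"
  shows "v \<bullet> (S *\<^sub>v v) = 0"
proof -
  have "v \<bullet> (S *\<^sub>v v) = (S\<^sup>T *\<^sub>v v) \<bullet> v"
    by (rule transpose_vec_mult_scalar[OF S v v, symmetric])
  also have "\<dots> = - (v \<bullet> (S *\<^sub>v v))"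
    using assms by (simp add: comm_scalar_prod[of v k "S *\<^sub>v v"])
  finally show ?thesis by simp
qed

text \<open>By skewness the squared norm of \<open>z\<close> has derivative zero. For the exosystem
  this bounds \<open>w\<close>, and with it the part of \<open>\<eta>\<close> that copies
  \<open>w\<close>.\<close>

lemma skew_flow_bounded:
  assumes z: "solves_ode k z (\<lambda>t. S *\<^sub>v z t)" and S: "S \<in> carrier_mat k k" "S\<^sup>T = - S"
  shows "bounded_traj k z"
proof (rule bounded_trajI)
  fix t :: real assume t: "t \<ge> 0"
  have z_carrier: "z s \<in> carrier_vec k" if "s \<ge> 0" for s using solves_odeD(1)[OF z that] .
  have "((\<lambda>s. z s \<bullet> z s) has_real_derivative 0) (at s within {0..})" if "s \<ge> 0" for s
    using solves_ode_scalar_prod[OF z z that] skew_quadratic_form[OF S z_carrier[OF that]]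
      z_carrier[OF that] S comm_scalar_prod[of "z s" k "S *\<^sub>v z s"] by simp
  from nonincreasing_half_line[OF this, of 0 t] t show "z t \<bullet> z t \<le> z 0 \<bullet> z 0" by simp
qed (rule solves_odeD[OF z])

text \<open>The coupling through \<open>F\<close> and its transpose exchanges energy without loss
  and \<open>S\<close> does no work, so only the damping by \<open>B * B\<^sup>T\<close> remains.
  This bounds both states, and Barbalat's lemma for the energy drives the damped output to
  zero.\<close>

lemma dissipative_network:
  fixes B F S :: "real mat"
  assumes B: "B \<in> carrier_mat n m" and F: "F \<in> carrier_mat n k" and S: "S \<in> carrier_mat k k" "S\<^sup>T = - S"
    and x: "solves_ode n x (\<lambda>t. F *\<^sub>v e t - B *\<^sub>v (B\<^sup>T *\<^sub>v x t))"
    and e: "solves_ode k e (\<lambda>t. S *\<^sub>v e t - F\<^sup>T *\<^sub>v x t)"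
  shows "bounded_traj n x" and "bounded_traj k e"
    and "\<And>i. i < m \<Longrightarrow> ((\<lambda>t. (B\<^sup>T *\<^sub>v x t) $ i) \<longlongrightarrow> 0) at_top"
proof -
  define V where "V = (\<lambda>t. x t \<bullet> x t + e t \<bullet> e t)"
  define y where "y = (\<lambda>t. B\<^sup>T *\<^sub>v x t)"
  define x' where "x' = (\<lambda>t. F *\<^sub>v e t - B *\<^sub>v y t)"
  define e' where "e' = (\<lambda>t. S *\<^sub>v e t - F\<^sup>T *\<^sub>v x t)"
  have x: "solves_ode n x x'" and e: "solves_ode k e e'"
    using x e by (simp_all add: x'_def e'_def y_def)
  have BT: "B\<^sup>T \<in> carrier_mat m n" and FT: "F\<^sup>T \<in> carrier_mat k n" using B F by auto
  have xc: "x t \<in> carrier_vec n" and ec: "e t \<in> carrier_vec k" if "t \<ge> 0" for t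
    using solves_odeD(1)[OF x that] solves_odeD(1)[OF e that] .
  have yc: "y t \<in> carrier_vec m" and x'c: "x' t \<in> carrier_vec n" and e'c: "e' t \<in> carrier_vec k"
    if "t \<ge> 0" for t
    using xc[OF that] ec[OF that] B F S by (auto simp: y_def x'_def e'_def)
  have V_deriv: "(V has_real_derivative - (2 * (y t \<bullet> y t))) (at t within {0..})" if t: "t \<ge> 0" for t
  proof -
    note c = xc[OF t] ec[OF t] yc[OF t] x'c[OF t] e'c[OF t]
    have Fe: "F *\<^sub>v e t \<in> carrier_vec n" and By: "B *\<^sub>v y t \<in> carrier_vec n"
      and Se: "S *\<^sub>v e t \<in> carrier_vec k" and Fx: "F\<^sup>T *\<^sub>v x t \<in> carrier_vec k"
      using c B F S by auto
    have "x t \<bullet> x' t = x t \<bullet> (F *\<^sub>v e t) - x t \<bullet> (B *\<^sub>v y t)"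
      unfolding x'_def by (rule scalar_prod_minus_distrib[OF c(1) Fe By])
    moreover have "x t \<bullet> (B *\<^sub>v y t) = y t \<bullet> y t"
      using transpose_vec_mult_scalar[OF B c(3) c(1)] by (simp add: y_def)
    moreover have "e t \<bullet> e' t = e t \<bullet> (S *\<^sub>v e t) - e t \<bullet> (F\<^sup>T *\<^sub>v x t)"
      unfolding e'_def by (rule scalar_prod_minus_distrib[OF c(2) Se Fx])
    \<comment> \<open>The coupling terms are adjoint to each other: this one cancels
      \<open>x t \<bullet> (F *\<^sub>v e t)\<close> in the sum below.\<close>
    moreover have "e t \<bullet> (F\<^sup>T *\<^sub>v x t) = x t \<bullet> (F *\<^sub>v e t)"
      using transpose_vec_mult_scalar[OF F c(2) c(1)] comm_scalar_prod[OF c(2) Fx] by simp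
    moreover have "e t \<bullet> (S *\<^sub>v e t) = 0"
      by (rule skew_quadratic_form[OF S c(2)])
    ultimately have "x t \<bullet> x' t + e t \<bullet> e' t = - (y t \<bullet> y t)" by simp
    moreover have "(V has_real_derivative
        (x' t \<bullet> x t + x t \<bullet> x' t) + (e' t \<bullet> e t + e t \<bullet> e' t)) (at t within {0..})"
      unfolding V_def
      by (intro derivative_intros solves_ode_scalar_prod[OF x x t] solves_ode_scalar_prod[OF e e t] c)
    ultimately show ?thesis
      using comm_scalar_prod[OF c(1) c(4)] comm_scalar_prod[OF c(2) c(5)]
      by (elim DERIV_cong) linarith
  qed
  have V_le: "V t \<le> V 0" if "t \<ge> 0" for t
    using nonincreasing_half_line[OF V_deriv, of 0 t] that scalar_prod_self_nonneg by simp
  show bx: "bounded_traj n x"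
  proof (rule bounded_trajI[OF xc])
    show "x t \<bullet> x t \<le> V 0" if "t \<ge> 0" for t
      using V_le[OF that] scalar_prod_self_nonneg[of "e t"] by (simp add: V_def)
  qed
  show be: "bounded_traj k e"
  proof (rule bounded_trajI[OF ec])
    show "e t \<bullet> e t \<le> V 0" if "t \<ge> 0" for t
      using V_le[OF that] scalar_prod_self_nonneg[of "x t"] by (simp add: V_def)
  qed
  \<comment> \<open>\<open>y'\<close> is the derivative of \<open>y\<close>. It is a linear image of
    \<open>x'\<close>, hence of the bounded \<open>e\<close> and \<open>y\<close>; its boundedness
    bounds the second derivative of \<open>V\<close>, as Barbalat's lemma requires.\<close>
  define y' where "y' = (\<lambda>t. B\<^sup>T *\<^sub>v x' t)"
  have y: "solves_ode m y y'"
    unfolding y_def y'_def by (rule solves_ode_mult_mat_vec[OF x BT x'c])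
  have y'c: "y' t \<in> carrier_vec m" if "t \<ge> 0" for t using BT x'c[OF that] by (simp add: y'_def)
  have bdd_y: "bounded_traj m y"
    unfolding y_def by (rule bounded_traj_mult_mat_vec[OF bx xc BT])
  have "bounded_traj n x'"
    unfolding x'_def using B F ec yc
    by (intro bounded_traj_minus bounded_traj_mult_mat_vec[OF be _ F]
        bounded_traj_mult_mat_vec[OF bdd_y _ B]) auto
  then have "bounded_traj m y'"
    unfolding y'_def by (rule bounded_traj_mult_mat_vec[OF _ x'c BT])
  from bounded_traj_scalar_prod[OF bdd_y this y'c]
  obtain L where L: "\<And>t. t \<ge> 0 \<Longrightarrow> \<bar>y t \<bullet> y' t\<bar> \<le> L" by blast
  have "((\<lambda>t. 2 * (y t \<bullet> y t)) \<longlongrightarrow> 0) at_top"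
  proof (rule barbalat[OF V_deriv])
    fix t :: real assume t: "t \<ge> 0"
    show "((\<lambda>t. 2 * (y t \<bullet> y t)) has_real_derivative 4 * (y t \<bullet> y' t)) (at t within {0..})"
      using DERIV_cmult[OF solves_ode_scalar_prod[OF y y t y'c[OF t] y'c[OF t]], of 2]
        comm_scalar_prod[OF yc[OF t] y'c[OF t]] by simp
    show "\<bar>4 * (y t \<bullet> y' t)\<bar> \<le> 4 * L" using L[OF t] by (simp add: abs_mult)
    show "V t \<ge> 0" "2 * (y t \<bullet> y t) \<ge> 0"
      using scalar_prod_self_nonneg by (auto simp: V_def)
  qed
  \<comment> \<open>The square root turns the dissipation rate into a bound for single entries of
    \<open>y\<close>; the factor 2 only enlarges it.\<close>
  then have y_tendsto: "((\<lambda>t. sqrt (2 * (y t \<bullet> y t))) \<longlongrightarrow> 0) at_top"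
    using tendsto_real_sqrt by fastforce
  show "((\<lambda>t. (B\<^sup>T *\<^sub>v x t) $ i) \<longlongrightarrow> 0) at_top" if i: "i < m" for i
  proof (rule Lim_null_comparison[OF _ y_tendsto])
    have "\<bar>y t $ i\<bar> \<le> sqrt (2 * (y t \<bullet> y t))" if "t \<ge> 0" for t
      using square_le_scalar_prod_self[of i "y t"] yc[OF that] i scalar_prod_self_nonneg[of "y t"]
      by (intro real_le_rsqrt) auto
    then show "\<forall>\<^sub>F t in at_top. norm ((B\<^sup>T *\<^sub>v x t) $ i) \<le> sqrt (2 * (y t \<bullet> y t))"
      unfolding y_def by (auto simp: eventually_at_top_linorder)
  qed
qed

subsection \<open>Kernels of real matrices\<close>

text \<open>Dependence is a property of the set of columns and would miss a repeated column;
  together with distinctness, independence excludes every nontrivial vanishing combination.\<close>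

lemma lin_indpt_cols_mult_eq_0:
  assumes A: "A \<in> carrier_mat n r" and "lin_indpt_cols A"
    and v: "v \<in> carrier_vec r" "A *\<^sub>v v = 0\<^sub>v n"
  shows "v = 0\<^sub>v r"
proof (rule ccontr)
  assume "v \<noteq> 0\<^sub>v r"
  moreover have "\<not> module.lin_dep class_ring (module_vec TYPE(real) n) (set (cols A))"
    and "distinct (cols A)"
    using assms by (auto simp: lin_indpt_cols_def)
  ultimately show False
    using vec_space.lin_depI[OF A v(1) _ v(2)] by blast
qed

text \<open>Injectivity gives a nonzero determinant, hence a unit of the matrix ring. This settles
  the option value in \<open>M_mat\<close>.\<close>

lemma mat_inverse_invertible:
  fixes A :: "real mat"
  assumes A: "A \<in> carrier_mat r r"
    and inj: "\<And>v. \<lbrakk>v \<in> carrier_vec r; A *\<^sub>v v = 0\<^sub>v r\<rbrakk> \<Longrightarrow> v = 0\<^sub>v r"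
  obtains C where "mat_inverse A = Some C" "C \<in> carrier_mat r r" "A * C = 1\<^sub>m r" "C * A = 1\<^sub>m r"
proof -
  have "det A \<noteq> 0"
    using det_0_iff_vec_prod_zero_field[OF A] inj by blast
  from det_non_zero_imp_unit[OF A this, where b = "()"] have "mat_inverse A \<noteq> None"
    using mat_inverse(1)[OF A, where b = "()"] by auto
  then show ?thesis
    using mat_inverse(2)[OF A] that by blast
qed

text \<open>Pairing the hypothesis with \<open>v\<close> shows that \<open>A *\<^sub>v v\<close> has
  squared norm zero. Hence the Gram matrix inherits injectivity from \<open>A\<close>.\<close>

lemma gram_mult_eq_0:
  fixes A :: "real mat"
  assumes A: "A \<in> carrier_mat n r" and v: "v \<in> carrier_vec r" and 0: "(A\<^sup>T * A) *\<^sub>v v = 0\<^sub>v r"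
  shows "A *\<^sub>v v = 0\<^sub>v n"
proof -
  have Av: "A *\<^sub>v v \<in> carrier_vec n" using A v by simp
  have "A\<^sup>T *\<^sub>v (A *\<^sub>v v) = 0\<^sub>v r" using 0 A v by (simp add: assoc_mult_mat_vec[of _ r n _ r])
  then have "(A *\<^sub>v v) \<bullet> (A *\<^sub>v v) = 0"
    using transpose_vec_mult_scalar[OF A v Av] v by simp
  then have "(A *\<^sub>v v) $ i = 0" if "i < n" for i
    using square_le_scalar_prod_self[of i "A *\<^sub>v v"] that A by simp
  then show ?thesis using A by (intro eq_vecI) auto
qed

text \<open>A square matrix and its transpose have the same determinant.\<close>

lemma square_mult_transpose_eq_0:
  fixes A :: "real mat"
  assumes A: "A \<in> carrier_mat n n" 
    and inj: "\<And>v. \<lbrakk>v \<in> carrier_vec n; A *\<^sub>v v = 0\<^sub>v n\<rbrakk> \<Longrightarrow> v = 0\<^sub>v n"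
    and v: "v \<in> carrier_vec n" "A\<^sup>T *\<^sub>v v = 0\<^sub>v n"
  shows "v = 0\<^sub>v n"
proof -
  have "det A \<noteq> 0"
    using det_0_iff_vec_prod_zero_field[OF A] inj by blast
  then show ?thesis
    using det_0_iff_vec_prod_zero_field[of "A\<^sup>T" n] det_transpose[OF A] A v by auto
qed

text \<open>Padding \<open>A\<close> with zero rows gives a square matrix of determinant zero, whose
  kernel vectors are also annihilated by \<open>A\<close>.\<close>

lemma wide_matrix_kernel:
  fixes A :: "real mat"
  assumes A: "A \<in> carrier_mat r n" and "r < n"
  obtains v where "v \<in> carrier_vec n" "v \<noteq> 0\<^sub>v n" "A *\<^sub>v v = 0\<^sub>v r"
proof -
  \<comment> \<open>The explicit zero row at index \<open>r\<close> in \<open>A'\<close> is the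
    shape expected by \<open>det_row_0\<close>; the rows after it are zero through
    \<open>c\<close>.\<close>
  define c where "c i = (if i < r then row A i else 0\<^sub>v n)" for i
  define A' where "A' = mat\<^sub>r n n (\<lambda>i. if i = r then 0\<^sub>v n else c i)"
  have c: "c i \<in> carrier_vec n" for i using A by (simp add: c_def)
  have A': "A' \<in> carrier_mat n n" by (simp add: A'_def)
  have "det A' = 0"
    unfolding A'_def using c by (intro det_row_0[OF \<open>r < n\<close>]) simp
  then obtain v where v: "v \<in> carrier_vec n" "v \<noteq> 0\<^sub>v n" "A' *\<^sub>v v = 0\<^sub>v n"
    using det_0_iff_vec_prod_zero_field[OF A'] by blast
  have "(A *\<^sub>v v) $ i = 0" if "i < r" for i
  proof -
    have "row A' i = c i"
      using that \<open>r < n\<close> c[of i] unfolding A'_def by (subst row_mat_of_row_fun) auto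
    then have "row A' i = row A i" using that by (simp add: c_def)
    then show ?thesis
      using that \<open>r < n\<close> A A' arg_cong[OF v(3), of "\<lambda>u. u $ i"] by simp
  qed
  then have "A *\<^sub>v v = 0\<^sub>v r" using A by (intro eq_vecI) auto
  then show ?thesis using v(1,2) that by blast
qed

subsection \<open>Incidence matrices of connected graphs\<close>

lemma scalar_prod_ones: "v \<in> carrier_vec n \<Longrightarrow> ones n \<bullet> v = (\<Sum>i<n. v $ i)"
  by (simp add: ones_def scalar_prod_def atLeast0LessThan)

lemma incidence_mat_carrier: "incidence_mat n m pos neg \<in> carrier_mat n m"
  by (simp add: incidence_mat_def)

locale incidence_graph =
  fixes G :: "nat pair_pre_digraph" and n m :: nat and pos neg :: "nat \<Rightarrow> nat"
  assumes graph: "pair_graph G" "pverts G = {0..<n}" "edge_labelling G m pos neg"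
    and conn: "Digraph_Component.connected (with_proj G)"
begin

interpretation pair_graph G by (rule graph)

abbreviation "B \<equiv> incidence_mat n m pos neg"

text \<open>Connectedness includes that there is at least one node.\<close>

lemma n_pos: "n > 0"
  using conn graph(2) by (auto simp: connected_def strongly_connected_def)

lemma edge_ends:
  assumes "k < m"
  shows "pos k < n" "neg k < n" "pos k \<noteq> neg k"
proof -
  have "{pos k, neg k} \<in> {{u, v} | u v. (u, v) \<in> parcs G}"
    using bij_betw_apply[OF graph(3)[unfolded edge_labelling_def], of k] assms by simp
  then obtain u v where uv: "(u, v) \<in> parcs G" "{pos k, neg k} = {u, v}" by auto
  have "u \<noteq> v" "u < n" "v < n"
    using uv(1) graph(2) no_loops[of "(u, v)"] wellformed[of "(u, v)"] by auto
  then show "pos k < n" "neg k < n" "pos k \<noteq> neg k"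
    using uv(2) by (auto simp: doubleton_eq_iff)
qed

text \<open>As the two ends of an edge differ, row \<open>k\<close> of the transpose is a difference
  of two unit vectors.\<close>

lemma incidence_transpose_mult_vec:
  assumes "k < m" "v \<in> carrier_vec n"
  shows "(B\<^sup>T *\<^sub>v v) $ k = v $ pos k - v $ neg k"
proof -
  note ends = edge_ends[OF assms(1)]
  have "(B\<^sup>T *\<^sub>v v) $ k = (\<Sum>i<n. (if i = pos k then v $ i else 0) - (if i = neg k then v $ i else 0))"
    using assms ends(3)
    by (auto simp: incidence_mat_def scalar_prod_def atLeast0LessThan intro!: sum.cong)
  also have "\<dots> = v $ pos k - v $ neg k"
    using ends by (simp add: sum_subtractf)
  finally show ?thesis .
qed

lemma incidence_transpose_mult_ones: "B\<^sup>T *\<^sub>v ones n = 0\<^sub>v m"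
proof (rule eq_vecI)
  fix k assume k: "k < dim_vec (0\<^sub>v m :: real vec)"
  then have "(B\<^sup>T *\<^sub>v ones n) $ k = ones n $ pos k - ones n $ neg k"
    by (intro incidence_transpose_mult_vec) (auto simp: ones_def)
  then show "(B\<^sup>T *\<^sub>v ones n) $ k = 0\<^sub>v m $ k"
    using k edge_ends[of k] by (simp add: ones_def)
qed (simp add: incidence_mat_def)

text \<open>Induction along a path between the two nodes. It is used with equality of entries for
  the kernel of the transposed incidence matrix, and with vanishing differences for
  consensus.\<close>

lemma connected_induct [consumes 2, case_names refl edge sym trans]:
  assumes "u < n" "v < n"
    and refl: "\<And>u. u < n \<Longrightarrow> R u u"
    and edge: "\<And>k. k < m \<Longrightarrow> R (pos k) (neg k)"
    and sym: "\<And>u v. \<lbrakk>R u v\<rbrakk> \<Longrightarrow> R v u"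
    and trans: "\<And>u v w. \<lbrakk>R u v; R v w\<rbrakk> \<Longrightarrow> R u w"
  shows "R u v"
proof -
  \<comment> \<open>Connectedness is defined through the symmetric closure; as arcs come in both
    directions, it already gives reachability in the graph itself.\<close>
  have "symmetric (with_proj G)" by (rule sym_arcs)
  then have "u \<rightarrow>\<^sup>*\<^bsub>with_proj G\<^esub> v"
    using conn assms(1,2) graph(2) reachable_mk_symmetric_eq
    by (auto simp: connected_def strongly_connected_def)
  then show ?thesis
  proof (induction rule: reachable_induct)
    case base
    then show ?case using refl assms(1) by simp
  next
    case (step x y)
    then have "(x, y) \<in> parcs G" by simp
    then have "{x, y} \<in> (\<lambda>k. {pos k, neg k}) ` {0..<m}"
      using graph(3) unfolding edge_labelling_def bij_betw_def by blast
    \<comment> \<open>An arc may run from the negative to the positive end of its edge, which is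
      where \<open>sym\<close> enters.\<close>
    then obtain k where k: "k < m" "x = pos k \<and> y = neg k \<or> x = neg k \<and> y = pos k"
      unfolding doubleton_eq_iff[symmetric] by auto
    then have "R x y"
      using edge[OF k(1)] sym by blast
    then show ?case by (rule trans[OF step.IH])
  qed
qed

lemma incidence_transpose_kernel:
  assumes v: "v \<in> carrier_vec n" "B\<^sup>T *\<^sub>v v = 0\<^sub>v m" and "i < n" "j < n"
  shows "v $ i = v $ j"
  using assms(3,4)
proof (induction rule: connected_induct)
  case (edge k)
  then show ?case using incidence_transpose_mult_vec[OF edge v(1)] v(2) by simp
qed auto

text \<open>With too few edges, the transposed incidence matrix extended by a row of ones would have
  a nonzero kernel vector. Connectedness makes this vector constant and the extra row makes its sum
  zero, a contradiction.\<close>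

lemma edges_ge: "n - 1 \<le> m"
proof (rule ccontr)
  assume "\<not> n - 1 \<le> m"
  then have lt: "m + 1 < n" by simp
  have BT: "B\<^sup>T \<in> carrier_mat m n" by (simp add: incidence_mat_def)
  have row: "mat_of_row (ones n) \<in> carrier_mat 1 n" by (simp add: ones_def mat_of_row_def)
  obtain v where v: "v \<in> carrier_vec n" "v \<noteq> 0\<^sub>v n" "(B\<^sup>T @\<^sub>r mat_of_row (ones n)) *\<^sub>v v = 0\<^sub>v (m + 1)"
    using wide_matrix_kernel[OF carrier_append_rows[OF BT row] lt] by blast
  have "(B\<^sup>T *\<^sub>v v) @\<^sub>v (mat_of_row (ones n) *\<^sub>v v) = 0\<^sub>v m @\<^sub>v 0\<^sub>v 1"
    using v(3) mat_mult_append[OF BT row v(1)] by auto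
  then have 0: "B\<^sup>T *\<^sub>v v = 0\<^sub>v m" "mat_of_row (ones n) *\<^sub>v v = 0\<^sub>v 1"
    using append_vec_eq[OF mult_mat_vec_carrier[OF BT v(1)] zero_carrier_vec] by auto
  have const: "v $ i = v $ 0" if "i < n" for i
    using incidence_transpose_kernel[OF v(1) 0(1) that n_pos] .
  have "ones n \<bullet> v = 0"
    using arg_cong[OF 0(2), of "\<lambda>u. u $ 0"] by simp
  moreover have "(\<Sum>i<n. v $ i) = (\<Sum>i<n. v $ 0)"
    by (rule sum.cong) (auto intro: const)
  ultimately have "v $ 0 = 0"
    using n_pos by (simp add: scalar_prod_ones[OF v(1)])
  then have "v $ i = 0" if "i < n" for i
    using const[OF that] by simp
  then have "v = 0\<^sub>v n"
    using v(1) by (intro eq_vecI) auto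
  with v(2) show False by simp
qed

end

subsection \<open>The matrices of the controller\<close>

lemma first_cols_carrier:
  assumes "A \<in> carrier_mat n m" "r \<le> m"
  shows "first_cols r A \<in> carrier_mat n r"
proof -
  have "length (take r (cols A)) = r" using carrier_matD[OF assms(1)] assms(2) by simp
  then show ?thesis
    using mat_of_cols_carrier(1)[of "dim_row A" "take r (cols A)"] carrier_matD(1)[OF assms(1)]
    unfolding first_cols_def by metis
qed

lemma first_cols_index:
  assumes "A \<in> carrier_mat n m" "r \<le> m" "i < n" "j < r"
  shows "first_cols r A $$ (i, j) = A $$ (i, j)"
proof -
  have "j < length (take r (cols A))" "i < dim_row A" using carrier_matD[OF assms(1)] assms(2-4) by simp_all
  then have "first_cols r A $$ (i, j) = take r (cols A) ! j $ i"
    unfolding first_cols_def by (intro mat_of_cols_index)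
  then show ?thesis using carrier_matD[OF assms(1)] assms(2-4) by simp
qed

lemma first_cols_transpose_mult_vec:
  assumes "A \<in> carrier_mat n m" "r \<le> m" "v \<in> carrier_vec n" "j < r"
  shows "((first_cols r A)\<^sup>T *\<^sub>v v) $ j = (A\<^sup>T *\<^sub>v v) $ j"
proof -
  have "col (first_cols r A) j = col A j"
    using assms first_cols_carrier[OF assms(1,2)] first_cols_index[OF assms(1,2)]
    by (intro eq_vecI) auto
  then show ?thesis
    using assms first_cols_carrier[OF assms(1,2)] by simp
qed

lemma append_zero_rows_mult_vec:
  fixes A :: "real mat"
  assumes A: "A \<in> carrier_mat r c" and v: "v \<in> carrier_vec c"
  shows "(A @\<^sub>r 0\<^sub>m k c) *\<^sub>v v = (A *\<^sub>v v) @\<^sub>v 0\<^sub>v k"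
proof -
  have "0\<^sub>m k c *\<^sub>v v = 0\<^sub>v k" using v by (intro eq_vecI) auto
  then show ?thesis using mat_mult_append[OF A zero_carrier_mat v, of k] by simp
qed

text \<open>The appended zeros switch off the later columns. With the zero rows of
  \<open>M_mat\<close>, this reduces multiplication by \<open>B\<close> to the independent columns
  \<open>first_cols (n - 1) B\<close>.\<close>

lemma mult_mat_vec_append_zero:
  fixes A :: "real mat"
  assumes A: "A \<in> carrier_mat n m" and "r \<le> m" and v: "v \<in> carrier_vec r"
  shows "A *\<^sub>v (v @\<^sub>v 0\<^sub>v (m - r)) = first_cols r A *\<^sub>v v"
proof (rule eq_vecI)
  note carrier = first_cols_carrier[OF assms(1,2)]
  fix i assume "i < dim_vec (first_cols r A *\<^sub>v v)"
  then have i: "i < n" using carrier by simp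
  have "(A *\<^sub>v (v @\<^sub>v 0\<^sub>v (m - r))) $ i = (\<Sum>j<m. if j < r then A $$ (i, j) * v $ j else 0)"
    using A v i \<open>r \<le> m\<close> by (auto simp: scalar_prod_def atLeast0LessThan intro!: sum.cong)
  also have "\<dots> = (\<Sum>j<r. A $$ (i, j) * v $ j)"
    using \<open>r \<le> m\<close> by (intro sum.mono_neutral_cong_right) auto
  also have "\<dots> = (first_cols r A *\<^sub>v v) $ i"
    using carrier v i first_cols_index[OF assms(1,2) i] by (simp add: scalar_prod_def atLeast0LessThan)
  finally show "(A *\<^sub>v (v @\<^sub>v 0\<^sub>v (m - r))) $ i = (first_cols r A *\<^sub>v v) $ i" .
qed (use A first_cols_carrier[OF assms(1,2)] in simp)

text \<open>The matrix with the columns of \<open>A\<close> and an additional all-ones column is square and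
  injective, hence so is its transpose.\<close>

lemma transpose_kernel_orthogonal_ones:
  fixes A :: "real mat"
  assumes A: "A \<in> carrier_mat (Suc r) r"
    and inj: "\<And>v. \<lbrakk>v \<in> carrier_vec r; A *\<^sub>v v = 0\<^sub>v (Suc r)\<rbrakk> \<Longrightarrow> v = 0\<^sub>v r"
    and ones: "A\<^sup>T *\<^sub>v ones (Suc r) = 0\<^sub>v r"
    and u: "u \<in> carrier_vec (Suc r)" "A\<^sup>T *\<^sub>v u = 0\<^sub>v r" "ones (Suc r) \<bullet> u = 0"
  shows "u = 0\<^sub>v (Suc r)"
proof -
  define D where "D = mat (Suc r) (Suc r) (\<lambda>(i, j). if j < r then A $$ (i, j) else 1)"
  have D: "D \<in> carrier_mat (Suc r) (Suc r)" by (simp add: D_def)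
  have ones_carrier: "ones (Suc r) \<in> carrier_vec (Suc r)" by (simp add: ones_def)
  show ?thesis
  proof (rule square_mult_transpose_eq_0[OF D _ u(1)])
    fix v assume v: "v \<in> carrier_vec (Suc r)" "D *\<^sub>v v = 0\<^sub>v (Suc r)"
    define v' where "v' = vec r (\<lambda>j. v $ j)"
    have v': "v' \<in> carrier_vec r" by (simp add: v'_def)
    have Dv: "(D *\<^sub>v v) $ i = (A *\<^sub>v v') $ i + v $ r" if "i < Suc r" for i
      using that A v(1) by (simp add: D_def v'_def scalar_prod_def)
    \<comment> \<open>Summing all rows isolates the last coefficient: the columns of
      \<open>A\<close> sum to zero, so only \<open>Suc r * v $ r\<close> is left.\<close>
    have "0 = (\<Sum>i<Suc r. (D *\<^sub>v v) $ i)" using v(2) by simp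
    also have "\<dots> = (\<Sum>i<Suc r. (A *\<^sub>v v') $ i + v $ r)"
      by (rule sum.cong) (simp_all add: Dv)
    also have "\<dots> = ones (Suc r) \<bullet> (A *\<^sub>v v') + Suc r * v $ r"
      unfolding scalar_prod_ones[OF mult_mat_vec_carrier[OF A v']] by (simp add: sum.distrib algebra_simps)
    also have "ones (Suc r) \<bullet> (A *\<^sub>v v') = 0"
      using transpose_vec_mult_scalar[OF A v' ones_carrier] ones v' by simp
    finally have last: "v $ r = 0" by simp
    then have "(A *\<^sub>v v') $ i = 0" if "i < Suc r" for i
      using Dv[OF that] v(2) that by simp
    then have "A *\<^sub>v v' = 0\<^sub>v (Suc r)" using A by (intro eq_vecI) auto
    then have v'_0: "v' = 0\<^sub>v r" by (rule inj[OF v'])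
    have "v $ j = 0" if "j < r" for j
    proof -
      have "v $ j = v' $ j" using that by (simp add: v'_def)
      then show ?thesis using that v'_0 by simp
    qed
    then show "v = 0\<^sub>v (Suc r)" using v(1) last by (intro eq_vecI) (auto simp: less_Suc_eq)
  next
    show "D\<^sup>T *\<^sub>v u = 0\<^sub>v (Suc r)"
    proof (rule eq_vecI)
      fix j assume j: "j < dim_vec (0\<^sub>v (Suc r) :: real vec)"
      show "(D\<^sup>T *\<^sub>v u) $ j = 0\<^sub>v (Suc r) $ j"
      proof (cases "j < r")
        case True
        then have "col D j = col A j" using A by (intro eq_vecI) (auto simp: D_def)
        then show ?thesis
          using True A D arg_cong[OF u(2), of "\<lambda>u. u $ j"] by simp
      next
        case False
        then have "col D j = ones (Suc r)" using j by (intro eq_vecI) (auto simp: D_def ones_def)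
        then show ?thesis using j D u(3) by simp
      qed
    qed (simp add: D_def)
  qed
qed

section \<open>The centring matrix and the feedforward gain\<close>

lemma Y_mat_carrier: "Y_mat n \<in> carrier_mat n n"
  unfolding Y_mat_def by (rule minus_carrier_mat[OF one_carrier_mat])

text \<open>\<open>Y_mat n\<close> is minus the orthogonal projection onto the vectors of entry sum
  zero.\<close>

lemma Y_mat_mult_vec:
  assumes v: "v \<in> carrier_vec n"
  shows "Y_mat n *\<^sub>v v = (ones n \<bullet> v / real n) \<cdot>\<^sub>v ones n - v"
proof (rule eq_vecI)
  fix i assume i: "i < dim_vec ((ones n \<bullet> v / real n) \<cdot>\<^sub>v ones n - v)"
  then have i: "i < n" using v by simp
  have "Y_mat n $$ (i, j) = 1 / n - (if i = j then 1 else 0)" if "j < n" for j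
    using i that by (simp add: Y_mat_def ones_def scalar_prod_def mat_of_cols_index mat_of_row_def)
  then have "Y_mat n $$ (i, j) * v $ j = v $ j / n - (if i = j then v $ j else 0)" if "j < n" for j
    using that by (simp add: left_diff_distrib)
  moreover have "(Y_mat n *\<^sub>v v) $ i = (\<Sum>j<n. Y_mat n $$ (i, j) * v $ j)"
    using i v Y_mat_carrier[of n] by (simp add: scalar_prod_def atLeast0LessThan)
  ultimately have "(Y_mat n *\<^sub>v v) $ i = (\<Sum>j<n. v $ j / n - (if i = j then v $ j else 0))"
    by simp
  also have "\<dots> = ones n \<bullet> v / n - v $ i"
    using i by (simp add: sum_subtractf sum_divide_distrib scalar_prod_ones[OF v])
  finally show "(Y_mat n *\<^sub>v v) $ i = ((ones n \<bullet> v / real n) \<cdot>\<^sub>v ones n - v) $ i"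
    using i v by (simp add: ones_def)
qed (use v Y_mat_carrier[of n] in simp)

lemma ones_scalar_prod_Y_mat:
  assumes v: "v \<in> carrier_vec n" and "n > 0"
  shows "ones n \<bullet> (Y_mat n *\<^sub>v v) = 0"
proof -
  have "ones n \<bullet> (Y_mat n *\<^sub>v v) = (\<Sum>i<n. (ones n \<bullet> v / real n) - v $ i)"
    using v by (subst scalar_prod_ones) (auto simp: Y_mat_mult_vec ones_def Y_mat_carrier)
  then show ?thesis
    using \<open>n > 0\<close> v by (simp add: sum_subtractf scalar_prod_ones)
qed

context incidence_graph
begin

text \<open>With \<open>A\<close> the independent columns and \<open>C\<close> the inverse of their
  Gram matrix, \<open>A * C * A\<^sup>T\<close> is the orthogonal projection onto the column space
  of \<open>A\<close>. These \<open>n - 1\<close> columns are orthogonal to \<open>ones n\<close>,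
  so they span all vectors of entry sum zero; in particular the projection fixes
  \<open>Y_mat n *\<^sub>v (P *\<^sub>v v)\<close>.\<close>

lemma M_mat_props:
  assumes Ba: "lin_indpt_cols (first_cols (n - 1) B)" and P: "P \<in> carrier_mat n p"
  shows M_mat_carrier: "M_mat n m B P \<in> carrier_mat m p"
    and M_mat_zero_row: "\<lbrakk>n - 1 \<le> i; i < m\<rbrakk> \<Longrightarrow> row (M_mat n m B P) i = 0\<^sub>v p"
    and incidence_mult_M_mat: "v \<in> carrier_vec p \<Longrightarrow>
      B *\<^sub>v (M_mat n m B P *\<^sub>v v) = (ones n \<bullet> (P *\<^sub>v v) / real n) \<cdot>\<^sub>v ones n - P *\<^sub>v v"
proof -
  define r where "r = n - 1"
  have n: "n = Suc r" using n_pos by (simp add: r_def)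
  have r: "r \<le> m" using edges_ge by (simp add: r_def)
  define A where "A = first_cols r B"
  have B: "B \<in> carrier_mat n m" by (rule incidence_mat_carrier)
  have A: "A \<in> carrier_mat n r" unfolding A_def by (rule first_cols_carrier[OF B r])
  have AT: "A\<^sup>T \<in> carrier_mat r n" using A by simp
  have gram: "A\<^sup>T * A \<in> carrier_mat r r" using A by simp
  have inj: "v = 0\<^sub>v r" if "v \<in> carrier_vec r" "A *\<^sub>v v = 0\<^sub>v n" for v
    using lin_indpt_cols_mult_eq_0[OF A _ that] Ba by (simp add: A_def r_def)
  obtain C where C: "mat_inverse (A\<^sup>T * A) = Some C" "C \<in> carrier_mat r r" "A\<^sup>T * A * C = 1\<^sub>m r"
    using mat_inverse_invertible[OF gram] inj gram_mult_eq_0[OF A] by metis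
  define Q where "Q = C * A\<^sup>T * Y_mat n * P"
  have Q: "Q \<in> carrier_mat r p" unfolding Q_def using C AT P Y_mat_carrier by auto
  have M: "M_mat n m B P = Q @\<^sub>r 0\<^sub>m (m - r) p"
    using P C(1) by (simp add: M_mat_def Let_def Q_def A_def r_def)
  have "Q @\<^sub>r 0\<^sub>m (m - r) p \<in> carrier_mat (r + (m - r)) p"
    using Q by (intro carrier_append_rows) auto
  then show "M_mat n m B P \<in> carrier_mat m p" using M r by simp
  show "row (M_mat n m B P) i = 0\<^sub>v p" if "n - 1 \<le> i" "i < m"
    using that Q r unfolding M by (intro eq_vecI) (auto simp: append_rows_def r_def)
  assume v: "v \<in> carrier_vec p"
  define y where "y = Y_mat n *\<^sub>v (P *\<^sub>v v)"
  have y: "y \<in> carrier_vec n" unfolding y_def using P v by (intro mult_mat_vec_carrier[OF Y_mat_carrier]) simp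
  define u where "u = A *\<^sub>v (C *\<^sub>v (A\<^sup>T *\<^sub>v y))"
  have CATy: "C *\<^sub>v (A\<^sup>T *\<^sub>v y) \<in> carrier_vec r" using C A y by simp
  have u: "u \<in> carrier_vec n" using A CATy by (simp add: u_def)
  have "Q *\<^sub>v v = C *\<^sub>v (A\<^sup>T *\<^sub>v y)"
    unfolding Q_def y_def using C AT P v Y_mat_carrier[of n]
    by (simp add: assoc_mult_mat_vec[of _ r n _ p] assoc_mult_mat_vec[of _ r n _ n]
        assoc_mult_mat_vec[of _ r r _ n])
  then have "M_mat n m B P *\<^sub>v v = C *\<^sub>v (A\<^sup>T *\<^sub>v y) @\<^sub>v 0\<^sub>v (m - r)"
    unfolding M using append_zero_rows_mult_vec[OF Q v] by simp
  then have "B *\<^sub>v (M_mat n m B P *\<^sub>v v) = u"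
    using mult_mat_vec_append_zero[OF B r CATy] by (simp add: u_def A_def)
  \<comment> \<open>\<open>u\<close> is the projection of \<open>y\<close>. The difference is killed
    by \<open>A\<^sup>T\<close> because \<open>C\<close> inverts the Gram matrix, and by
    \<open>ones n\<close> because \<open>u\<close> and \<open>y\<close> both have entry sum
    zero.\<close>
  moreover have "u - y = 0\<^sub>v (Suc r)"
  proof (rule transpose_kernel_orthogonal_ones)
    show "A \<in> carrier_mat (Suc r) r" using A n by simp
    show "v = 0\<^sub>v r" if "v \<in> carrier_vec r" "A *\<^sub>v v = 0\<^sub>v (Suc r)" for v
      using inj that n by simp
    have ones_n: "ones n \<in> carrier_vec n" by (simp add: ones_def)
    have AT_ones: "A\<^sup>T *\<^sub>v ones n = 0\<^sub>v r"
    proof (rule eq_vecI)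
      fix j assume "j < dim_vec (0\<^sub>v r :: real vec)"
      then show "(A\<^sup>T *\<^sub>v ones n) $ j = 0\<^sub>v r $ j"
        using first_cols_transpose_mult_vec[OF B r ones_n, of j] r
        by (simp add: A_def incidence_transpose_mult_ones)
    qed (use A in simp)
    then show "A\<^sup>T *\<^sub>v ones (Suc r) = 0\<^sub>v r" using n by simp
    show "u - y \<in> carrier_vec (Suc r)" using u y n by simp
    have "A\<^sup>T *\<^sub>v u = (A\<^sup>T * A * C) *\<^sub>v (A\<^sup>T *\<^sub>v y)"
      using A AT C(2) y gram CATy unfolding u_def
      by (simp add: assoc_mult_mat_vec[of _ r r _ r] assoc_mult_mat_vec[of _ r n _ r])
    also have "\<dots> = A\<^sup>T *\<^sub>v y"
      using C(3) AT y by simp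
    finally show "A\<^sup>T *\<^sub>v (u - y) = 0\<^sub>v r"
      using mult_minus_distrib_mat_vec[OF AT u y] AT y by simp
    have "ones n \<bullet> u = 0"
      using transpose_vec_mult_scalar[OF A CATy ones_n] AT_ones CATy by (simp add: u_def)
    moreover have "ones n \<bullet> y = 0"
      using P v ones_scalar_prod_Y_mat[OF _ n_pos] by (simp add: y_def)
    ultimately show "ones (Suc r) \<bullet> (u - y) = 0"
      using scalar_prod_minus_distrib[OF ones_n u y] n by simp
  qed
  then have "(u - y) $ i = 0" if "i < n" for i
    using that n by simp
  then have "u = y"
    using u y by (intro eq_vecI) auto
  ultimately show "B *\<^sub>v (M_mat n m B P *\<^sub>v v) = (ones n \<bullet> (P *\<^sub>v v) / real n) \<cdot>\<^sub>v ones n - P *\<^sub>v v"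
    using P v Y_mat_mult_vec by (simp add: y_def)
qed

end

section \<open>Stacked vectors and block-diagonal matrices\<close>

lemma sum_div_mod:
  "(\<Sum>j<N * p. f (j div p) (j mod p)) = (\<Sum>k<N. \<Sum>l<p. f k l)" for f :: "nat \<Rightarrow> nat \<Rightarrow> real"
proof -
  have "(\<Sum>j<N * p. f (j div p) (j mod p)) = (\<Sum>k<N. \<Sum>j = k * p..<k * p + p. f (j div p) (j mod p))"
    by (rule sum.nat_group[symmetric])
  also have "\<dots> = (\<Sum>k<N. \<Sum>l<p. f k l)"
  proof (rule sum.cong)
    fix k
    have "(\<Sum>j = 0 + k * p..<p + k * p. f (j div p) (j mod p)) =
        (\<Sum>l = 0..<p. f ((l + k * p) div p) ((l + k * p) mod p))"
      by (rule sum.shift_bounds_nat_ivl)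
    also have "\<dots> = (\<Sum>l<p. f k l)"
      by (intro sum.cong) (auto simp: atLeast0LessThan)
    finally show "(\<Sum>j = k * p..<k * p + p. f (j div p) (j mod p)) = (\<Sum>l<p. f k l)"
      by (simp add: add.commute)
  qed simp
  finally show ?thesis .
qed

text \<open>For \<open>v = w t\<close> and \<open>N = n - 1\<close> this is the internal model state
  synchronized with the exosystem, the reference from which \<open>\<eta>\<close> is
  measured.\<close>

definition replicate_vec :: "nat \<Rightarrow> real vec \<Rightarrow> real vec" where
  "replicate_vec N v = vec (N * dim_vec v) (\<lambda>i. v $ (i mod dim_vec v))"

lemma replicate_vec_carrier: "v \<in> carrier_vec p \<Longrightarrow> replicate_vec N v \<in> carrier_vec (N * p)"
  unfolding replicate_vec_def by (metis carrier_vecD vec_carrier)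

lemma mod_block_less: "i < N * p \<Longrightarrow> i mod p < (p :: nat)"
  by (cases "p = 0") auto

lemma div_block_less: "i < N * p \<Longrightarrow> i div p < (N :: nat)"
  by (simp add: less_mult_imp_div_less)

lemma replicate_vec_index:
  assumes "v \<in> carrier_vec p" "i < N * p"
  shows "replicate_vec N v $ i = v $ (i mod p)"
  using assms by (simp add: replicate_vec_def)

lemma diag_block_mat_carrier:
  assumes "\<And>j. j < N \<Longrightarrow> f j \<in> carrier_mat (a j) (b j)"
  shows "diag_block_mat (map f [0..<N]) \<in> carrier_mat (\<Sum>j<N. a j) (\<Sum>j<N. b j)"
proof -
  have sum_list: "(\<Sum>j\<leftarrow>[0..<N]. h j) = (\<Sum>j<N. h j)" for h :: "nat \<Rightarrow> nat"
    by (simp add: interv_sum_list_conv_sum_set_nat atLeast0LessThan)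
  have "(\<Sum>j<N. dim_row (f j)) = (\<Sum>j<N. a j)" "(\<Sum>j<N. dim_col (f j)) = (\<Sum>j<N. b j)"
    using carrier_matD[OF assms] by (auto intro!: sum.cong)
  then show ?thesis
    unfolding carrier_mat_def by (simp add: dim_diag_block_mat comp_def sum_list)
qed

lemma diag_block_mat_rows_carrier:
  assumes "\<And>k. k < N \<Longrightarrow> r k \<in> carrier_vec p"
  shows "diag_block_mat (map (\<lambda>k. mat_of_row (r k)) [0..<N]) \<in> carrier_mat N (N * p)"
proof -
  have "mat_of_row (r k) \<in> carrier_mat 1 p" if "k < N" for k
    using assms[OF that] by (simp add: mat_of_row_def)
  from diag_block_mat_carrier[OF this] show ?thesis by simp
qed

text \<open>The induction peels off the last block, since the index list grows at its end: the new
  block occupies row \<open>N\<close> and the columns from \<open>N * p\<close> on.\<close>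

lemma diag_block_mat_rows_index:
  assumes "\<And>k. k < N \<Longrightarrow> r k \<in> carrier_vec p" "i < N" "j < N * p"
  shows "diag_block_mat (map (\<lambda>k. mat_of_row (r k)) [0..<N]) $$ (i, j) =
    (if j div p = i then r i $ (j mod p) else (0 :: real))"
  using assms
proof (induction N)
  case (Suc N)
  define D where "D = diag_block_mat (map (\<lambda>k. mat_of_row (r k)) [0..<N])"
  have D: "D \<in> carrier_mat N (N * p)"
    unfolding D_def using Suc.prems(1) by (intro diag_block_mat_rows_carrier) simp
  have IH: "D $$ (i, j) = (if j div p = i then r i $ (j mod p) else 0)" if "i < N" "j < N * p"
    unfolding D_def using Suc.IH Suc.prems(1) that by simp
  have rN: "dim_vec (r N) = p" using Suc.prems(1)[of N] by simp
  have "diag_block_mat (map (\<lambda>k. mat_of_row (r k)) [0..<Suc N]) $$ (i, j) =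
      four_block_mat D (0\<^sub>m N p) (0\<^sub>m 1 (N * p)) (mat_of_row (r N)) $$ (i, j)"
    using D rN by (simp add: diag_block_mat_last Let_def D_def mat_of_row_def)
  also have "\<dots> = (if i < N then if j < N * p then D $$ (i, j) else 0
      else if j < N * p then 0 else r N $ (j - N * p))"
    using Suc.prems(2,3) D rN by (auto simp: mat_of_row_def less_Suc_eq)
  also have "\<dots> = (if j div p = i then r i $ (j mod p) else 0)"
  proof (cases "j < N * p")
    case True
    then show ?thesis using Suc.prems(2) IH div_block_less[OF True] by (auto simp: less_Suc_eq)
  next
    case False
    then obtain l where l: "j = l + N * p" "l < p"
      using Suc.prems(3) by (metis add.commute le_Suc_ex mult_Suc nat_add_left_cancel_less not_less)
    then have "j div p = N" "j mod p = j - N * p" by auto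
    then show ?thesis using False Suc.prems(2) by (auto simp: less_Suc_eq)
  qed
  finally show ?case .
qed simp

lemma H_bar_carrier:
  assumes M: "M \<in> carrier_mat m p" and "n - 1 \<le> m"
  shows "H_bar n m M \<in> carrier_mat m ((n - 1) * p)"
proof -
  have "H_bar n m M \<in> carrier_mat ((n - 1) + (m - (n - 1))) ((n - 1) * p)"
    unfolding H_bar_def carrier_matD(2)[OF M]
    by (intro carrier_append_rows diag_block_mat_rows_carrier carrier_vecI) (use M in auto)
  then show ?thesis using assms(2) by simp
qed

text \<open>Row \<open>i < n - 1\<close> of \<open>H_bar\<close> applies row \<open>i\<close> of
  \<open>M\<close> to the copy of \<open>v\<close> in block \<open>i\<close>; the other rows give
  zero on both sides. Thus the synchronized internal model outputs the flow
  \<open>M *\<^sub>v w t\<close>.\<close>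

lemma H_bar_mult_replicate_vec:
  assumes M: "M \<in> carrier_mat m p" and nm: "n - 1 \<le> m"
    and zero_rows: "\<And>i. \<lbrakk>n - 1 \<le> i; i < m\<rbrakk> \<Longrightarrow> row M i = 0\<^sub>v p"
    and v: "v \<in> carrier_vec p"
  shows "H_bar n m M *\<^sub>v replicate_vec (n - 1) v = M *\<^sub>v v"
proof (rule eq_vecI)
  define N where "N = n - 1"
  define D where "D = diag_block_mat (map (\<lambda>k. mat_of_row (row M k)) [0..<N])"
  have rows: "row M k \<in> carrier_vec p" if "k < N" for k
    using M by (intro carrier_vecI) simp
  have D: "D \<in> carrier_mat N (N * p)"
    unfolding D_def by (rule diag_block_mat_rows_carrier[OF rows])
  have rep: "replicate_vec N v \<in> carrier_vec (N * p)" by (rule replicate_vec_carrier[OF v])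
  have H: "H_bar n m M *\<^sub>v replicate_vec N v = (D *\<^sub>v replicate_vec N v) @\<^sub>v 0\<^sub>v (m - N)"
    using append_zero_rows_mult_vec[OF D rep] M by (simp add: H_bar_def N_def D_def)
  fix i assume "i < dim_vec (M *\<^sub>v v)"
  then have i: "i < m" using M by simp
  show "(H_bar n m M *\<^sub>v replicate_vec (n - 1) v) $ i = (M *\<^sub>v v) $ i"
  proof (cases "i < N")
    case True
    have "(D *\<^sub>v replicate_vec N v) $ i =
        (\<Sum>j<N * p. (if j div p = i then M $$ (i, j mod p) * v $ (j mod p) else 0))"
      using True D rep i M mod_block_less[of _ N p]
      by (auto simp: scalar_prod_def atLeast0LessThan D_def diag_block_mat_rows_index[OF rows]
          replicate_vec_index[OF v] intro!: sum.cong)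
    also have "\<dots> = (\<Sum>k<N. \<Sum>l<p. (if k = i then M $$ (i, l) * v $ l else 0))"
      by (rule sum_div_mod[of "\<lambda>k l. if k = i then M $$ (i, l) * v $ l else 0"])
    also have "\<dots> = (\<Sum>k<N. if k = i then \<Sum>l<p. M $$ (i, l) * v $ l else 0)"
      by (intro sum.cong) auto
    also have "\<dots> = (M *\<^sub>v v) $ i"
      using True i M v by (simp add: scalar_prod_def atLeast0LessThan)
    finally show ?thesis using H True D by (simp add: N_def)
  next
    case False
    then show ?thesis using H D i M v zero_rows[of i] by (simp add: N_def)
  qed
qed (use H_bar_carrier[OF M nm] M in simp)

section \<open>The internal model matrix and skew symmetry\<close>

lemma S_bar_carrier: "Sd \<in> carrier_mat p p \<Longrightarrow> S_bar n Sd \<in> carrier_mat ((n - 1) * p) ((n - 1) * p)"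
  by (simp add: S_bar_def kronecker_mat_def)

lemma S_bar_index:
  assumes "Sd \<in> carrier_mat p p" "i < (n - 1) * p" "j < (n - 1) * p"
  shows "S_bar n Sd $$ (i, j) = (if j div p = i div p then Sd $$ (i mod p, j mod p) else 0)"
  using assms div_block_less[of i "n - 1" p] div_block_less[of j "n - 1" p]
  by (simp add: S_bar_def kronecker_mat_def)

text \<open>The Kronecker product with the identity acts on every copy separately, so the stacked
  copies of \<open>w\<close> solve the undriven internal model.\<close>

lemma S_bar_mult_replicate_vec:
  assumes Sd: "Sd \<in> carrier_mat p p" and v: "v \<in> carrier_vec p"
  shows "S_bar n Sd *\<^sub>v replicate_vec (n - 1) v = replicate_vec (n - 1) (Sd *\<^sub>v v)"
proof (rule eq_vecI)
  define N where "N = n - 1"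
  have Sv: "Sd *\<^sub>v v \<in> carrier_vec p" using Sd v by simp
  fix i assume "i < dim_vec (replicate_vec (n - 1) (Sd *\<^sub>v v))"
  then have i: "i < N * p" using Sd by (simp add: replicate_vec_def N_def)
  then have im: "i mod p < p" "i div p < N" by (auto intro: mod_block_less div_block_less)
  have "(S_bar n Sd *\<^sub>v replicate_vec N v) $ i =
      (\<Sum>j<N * p. (if j div p = i div p then Sd $$ (i mod p, j mod p) * v $ (j mod p) else 0))"
    using i S_bar_carrier[OF Sd, of n] replicate_vec_carrier[OF v, of N]
    by (auto simp: scalar_prod_def atLeast0LessThan S_bar_index[OF Sd] N_def
        replicate_vec_index[OF v] intro!: sum.cong)
  also have "\<dots> = (\<Sum>k<N. \<Sum>l<p. (if k = i div p then Sd $$ (i mod p, l) * v $ l else 0))"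
    by (rule sum_div_mod[of "\<lambda>k l. if k = i div p then Sd $$ (i mod p, l) * v $ l else 0"])
  also have "\<dots> = (\<Sum>k<N. if k = i div p then \<Sum>l<p. Sd $$ (i mod p, l) * v $ l else 0)"
    by (intro sum.cong) auto
  also have "\<dots> = (Sd *\<^sub>v v) $ (i mod p)"
    using im Sd v by (simp add: scalar_prod_def atLeast0LessThan)
  finally show "(S_bar n Sd *\<^sub>v replicate_vec (n - 1) v) $ i = replicate_vec (n - 1) (Sd *\<^sub>v v) $ i"
    using i Sv by (simp add: replicate_vec_index N_def)
qed (use S_bar_carrier[OF Sd, of n] Sd in \<open>simp add: replicate_vec_def\<close>)

lemma skew_index:
  assumes "A \<in> carrier_mat k k" "A\<^sup>T = - A" "i < k" "j < k"
  shows "A $$ (j, i) = - (A $$ (i, j) :: real)"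
proof -
  have "A $$ (j, i) = A\<^sup>T $$ (i, j)" using assms(1,3,4) by simp
  also have "\<dots> = (- A) $$ (i, j)" by (simp only: assms(2))
  finally show ?thesis using assms(1,3,4) by simp
qed

text \<open>Swapping the indices keeps the test for equal blocks and transposes the position within
  \<open>Sd\<close>.\<close>

lemma S_bar_skew:
  assumes Sd: "Sd \<in> carrier_mat p p" "Sd\<^sup>T = - Sd"
  shows "(S_bar n Sd)\<^sup>T = - S_bar n Sd"
proof (rule eq_matI)
  fix i j assume "i < dim_row (- S_bar n Sd)" "j < dim_col (- S_bar n Sd)"
  then have ij: "i < (n - 1) * p" "j < (n - 1) * p" using S_bar_carrier[OF Sd(1), of n] by auto
  then show "(S_bar n Sd)\<^sup>T $$ (i, j) = (- S_bar n Sd) $$ (i, j)"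
    using S_bar_carrier[OF Sd(1), of n] S_bar_index[OF Sd(1)] mod_block_less[OF ij(1)]
      mod_block_less[OF ij(2)] skew_index[OF Sd, of "i mod p" "j mod p"] by auto
qed (use S_bar_carrier[OF Sd(1), of n] in auto)

text \<open>Peeling off the first block, transposition exchanges the two zero blocks and acts
  separately on the diagonal blocks, which are skew.\<close>

lemma diag_block_mat_skew:
  assumes "\<And>A. A \<in> set As \<Longrightarrow> square_mat A \<and> A\<^sup>T = - (A :: real mat)"
  shows "(diag_block_mat As)\<^sup>T = - diag_block_mat As"
  using assms
proof (induction As)
  case Nil
  show ?case by (rule eq_matI) auto
next
  case (Cons A As)
  define D where "D = diag_block_mat As"
  define a d where "a = dim_row A" and "d = dim_row D"
  have sq: "Ball (set (A # As)) square_mat" using Cons.prems by blast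
  have "dim_col A = dim_row A" using sq by simp
  then have A: "A \<in> carrier_mat a a" by (simp only: carrier_mat_def a_def) simp
  have AT: "A\<^sup>T = - A" using Cons.prems[OF list.set_intros(1)] by (rule conjunct2)
  have "square_mat D" unfolding D_def using sq by (intro diag_block_mat_square) simp
  then have "dim_col D = dim_row D" by simp
  then have D: "D \<in> carrier_mat d d" by (simp only: carrier_mat_def d_def) simp
  have DT: "D\<^sup>T = - D"
    unfolding D_def by (rule Cons.IH[OF Cons.prems[OF list.set_intros(2)]])
  define E where "E = diag_block_mat (A # As)"
  have "E = four_block_mat A (0\<^sub>m (dim_row A) (dim_col D)) (0\<^sub>m (dim_row D) (dim_col A)) D"
    by (simp only: E_def diag_block_mat.simps Let_def D_def)
  then have E: "E = four_block_mat A (0\<^sub>m a d) (0\<^sub>m d a) D"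
    by (simp only: carrier_matD[OF A] carrier_matD[OF D])
  have dim: "dim_row E = a + d" "dim_col E = a + d"
    unfolding E using A D by simp_all
  have index: "E $$ (i, j) = (if i < a then if j < a then A $$ (i, j) else 0
      else if j < a then 0 else D $$ (i - a, j - a))"
    if "i < a + d" "j < a + d" for i j
    using that A D unfolding E by simp
  have "E\<^sup>T = - E"
  proof (rule eq_matI)
    fix i j assume "i < dim_row (- E)" "j < dim_col (- E)"
    then have ij: "i < a + d" "j < a + d" using dim by simp_all
    have "E $$ (j, i) = - (E $$ (i, j))"
      unfolding index[OF ij] index[OF ij(2,1)]
      using ij skew_index[OF A AT, of i j] skew_index[OF D DT, of "i - a" "j - a"] by simp
    then show "E\<^sup>T $$ (i, j) = (- E) $$ (i, j)"
      using ij dim by simp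
  qed (use dim in simp_all)
  then show ?case by (simp only: E_def)
qed

subsection \<open>The closed loop\<close>

lemma ones_carrier: "ones n \<in> carrier_vec n"
  by (simp add: ones_def)

lemma minus_vec_right_commute:
  fixes a b c :: "real vec"
  assumes "b \<in> carrier_vec k" "a \<in> carrier_vec k" "c \<in> carrier_vec k"
  shows "a - b - c = a - c - b"
  using assms by (intro eq_vecI) auto

lemma solves_ode_const: "v \<in> carrier_vec k \<Longrightarrow> solves_ode k (\<lambda>_. v) (\<lambda>_. 0\<^sub>v k)"
  by (simp add: solves_ode_def)

text \<open>Fundamental theorem of calculus; the integrand is continuous because \<open>w\<close> is
  differentiable.\<close>

lemma drift_has_real_derivative:
  assumes w: "solves_ode p w f" and f: "\<And>t. t \<ge> 0 \<Longrightarrow> f t \<in> carrier_vec p"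
    and P: "P \<in> carrier_mat n p" and t: "t \<ge> 0"
  shows "(drift n P w has_real_derivative ones n \<bullet> (P *\<^sub>v w t) / real n) (at t within {0..})"
proof -
  define g where "g = (\<lambda>s. ones n \<bullet> (P *\<^sub>v w s) / real n)"
  have "continuous (at s within {0..}) g" if s: "s \<ge> 0" for s
  proof -
    have "P *\<^sub>v f s \<in> carrier_vec n" using P f[OF s] by simp
    from solves_ode_scalar_prod[OF solves_ode_const[OF ones_carrier] solves_ode_mult_mat_vec[OF w P f] s _ this]
    have "continuous (at s within {0..}) (\<lambda>s. ones n \<bullet> (P *\<^sub>v w s))"
      by (intro DERIV_continuous) simp
    then show ?thesis unfolding g_def divide_inverse by (intro continuous_intros)
  qed
  then have "continuous_on {0..} g" by (simp add: continuous_on_eq_continuous_within)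
  \<comment> \<open>Ending the compact interval at \<open>t + 1\<close> keeps \<open>t\<close> off
    its right end, so the derivative within it agrees with the one within the half line.\<close>
  then have "continuous_on {0..t + 1} g" by (rule continuous_on_subset) auto
  from integral_has_real_derivative[OF this, of t] t
  have "((\<lambda>x. integral {0..x} g) has_real_derivative g t) (at t within {0..t + 1})" by simp
  moreover have "at t within {0..t + 1} = at t within {0..}"
    by (rule at_within_nhd[of t "{..<t + 1}"]) auto
  moreover have "drift n P w = (\<lambda>x. integral {0..x} g)"
    by (simp add: drift_def g_def fun_eq_iff)
  ultimately show ?thesis by (simp add: g_def)
qed

lemma solves_ode_smult_ones:
  assumes "\<And>t. t \<ge> 0 \<Longrightarrow> (\<phi> has_real_derivative \<phi>' t) (at t within {0..})"
  shows "solves_ode n (\<lambda>t. \<phi> t \<cdot>\<^sub>v ones n) (\<lambda>t. \<phi>' t \<cdot>\<^sub>v ones n)"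
  using assms by (simp add: solves_ode_def ones_def)

lemma solves_ode_replicate_vec:
  assumes w: "solves_ode p w f" and f: "\<And>t. t \<ge> 0 \<Longrightarrow> f t \<in> carrier_vec p"
  shows "solves_ode (N * p) (\<lambda>t. replicate_vec N (w t)) (\<lambda>t. replicate_vec N (f t))"
  unfolding solves_ode_def
proof (intro allI impI conjI)
  fix t :: real and i assume t: "t \<ge> 0"
  show "replicate_vec N (w t) \<in> carrier_vec (N * p)"
    by (rule replicate_vec_carrier[OF solves_odeD(1)[OF w t]])
  assume i: "i < N * p"
  show "((\<lambda>s. replicate_vec N (w s) $ i) has_real_derivative replicate_vec N (f t) $ i) (at t within {0..})"
    unfolding replicate_vec_index[OF f[OF t] i]
    by (rule has_real_derivative_cong_half_line[OF solves_odeD(2)[OF w t mod_block_less[OF i]] t])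
      (rule replicate_vec_index[OF solves_odeD(1)[OF w] i])
qed

lemma bounded_traj_replicate_vec:
  assumes "bounded_traj p w" "\<And>t. t \<ge> 0 \<Longrightarrow> w t \<in> carrier_vec p"
  shows "bounded_traj (N * p) (\<lambda>t. replicate_vec N (w t))"
  unfolding bounded_traj_iff
proof (intro allI impI)
  fix i assume i: "i < N * p"
  then show "\<exists>C. \<forall>t\<ge>0. \<bar>replicate_vec N (w t) $ i\<bar> \<le> C"
    using assms(1) mod_block_less[OF i] replicate_vec_index[OF assms(2) i]
    unfolding bounded_traj_iff by simp
qed

section \<open>Convergence of the entries to their average\<close>

context incidence_graph
begin

text \<open>Differences across edges vanish in the limit, and by connectedness so do all pairwise
  differences. As the total is \<open>C\<close>, the product \<open>n * x t $ i\<close> equals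
  \<open>C\<close> plus the sum of the differences \<open>x t $ i - x t $ j\<close>.\<close>

lemma consensus:
  fixes x :: "real \<Rightarrow> real vec"
  assumes x: "\<And>t. t \<ge> 0 \<Longrightarrow> x t \<in> carrier_vec n"
    and edges: "\<And>k. k < m \<Longrightarrow> ((\<lambda>t. (B\<^sup>T *\<^sub>v x t) $ k) \<longlongrightarrow> 0) at_top"
    and total: "\<And>t. t \<ge> 0 \<Longrightarrow> ones n \<bullet> x t = C"
    and i: "i < n"
  shows "((\<lambda>t. x t $ i) \<longlongrightarrow> C / n) at_top"
proof -
  have diff: "((\<lambda>t. x t $ i - x t $ j) \<longlongrightarrow> 0) at_top" if "j < n" for j
    using i that
  proof (induction rule: connected_induct)
    case (edge k)
    have "\<forall>\<^sub>F t in at_top. (B\<^sup>T *\<^sub>v x t) $ k = x t $ pos k - x t $ neg k"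
      using eventually_ge_at_top[of "0 :: real"]
      by eventually_elim (rule incidence_transpose_mult_vec[OF edge x])
    with edges[OF edge] show ?case by (simp add: tendsto_cong)
  next
    case (sym u v)
    from tendsto_minus[OF sym] show ?case by simp
  next
    case (trans u v w)
    from tendsto_add[OF trans] show ?case by simp
  qed simp
  have "((\<lambda>t. (C + (\<Sum>j<n. x t $ i - x t $ j)) / n) \<longlongrightarrow> (C + (\<Sum>j<n. 0)) / n) at_top"
    by (intro tendsto_intros diff) (use n_pos in auto)
  moreover have "\<forall>\<^sub>F t in at_top. (C + (\<Sum>j<n. x t $ i - x t $ j)) / n = x t $ i"
    using eventually_ge_at_top[of "0 :: real"]
  proof eventually_elim
    case (elim t)
    then have "(\<Sum>j<n. x t $ i - x t $ j) = n * x t $ i - C"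
      using total[of t] scalar_prod_ones[OF x[of t]] by (simp add: sum_subtractf)
    then show ?case using n_pos by simp
  qed
  ultimately show ?thesis by (simp add: tendsto_cong)
qed

end

section \<open>Deviation dynamics and stability of the closed loop\<close>

theorem theorem1:
  fixes n m q p :: nat and G :: "nat pair_pre_digraph" and pos neg :: "nat \<Rightarrow> nat"
    and pd :: "nat \<Rightarrow> nat" and Sdj \<Gamma>dj :: "nat \<Rightarrow> real mat"
    and B P0 Sd \<Gamma>d P M Sbar Hbar :: "real mat"
    and x lam \<eta> w d :: "real \<Rightarrow> real vec"
  assumes graph: "pair_graph G" "pverts G = {0..<n}" "edge_labelling G m pos neg"
    and conn: "Digraph_Component.connected (with_proj G)"
    and B: "B = incidence_mat n m pos neg"
    and Ba: "lin_indpt_cols (first_cols (n - 1) B)"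
    and q: "q \<le> n"
    and Sdj: "\<And>j. j < q \<Longrightarrow> Sdj j \<in> carrier_mat (pd j) (pd j)"
    and \<Gamma>dj: "\<And>j. j < q \<Longrightarrow> \<Gamma>dj j \<in> carrier_mat 1 (pd j)"
    and p: "p = (\<Sum>j<q. pd j)"
    and Sd: "Sd = diag_block_mat (map Sdj [0..<q])"
    and \<Gamma>d: "\<Gamma>d = diag_block_mat (map \<Gamma>dj [0..<q])"
    and P0: "P0 \<in> carrier_mat n q"
    and P: "P = P0 * \<Gamma>d"
    and skew: "\<And>j. j < q \<Longrightarrow> (Sdj j)\<^sup>T = - Sdj j"
    and M: "M = M_mat n m B P"
    and Sbar: "Sbar = S_bar n Sd"
    and Hbar: "Hbar = H_bar n m M"
    and exosystem: "solves_ode p w (\<lambda>t. Sd *\<^sub>v w t)"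
    and disturbance: "\<And>t. t \<ge> 0 \<Longrightarrow> d t = \<Gamma>d *\<^sub>v w t"
    and plant: "solves_ode n x (\<lambda>t. B *\<^sub>v lam t + P0 *\<^sub>v d t)"
    and controller_state:
      "solves_ode ((n - 1) * p) \<eta> (\<lambda>t. Sbar *\<^sub>v \<eta> t - Hbar\<^sup>T *\<^sub>v (B\<^sup>T *\<^sub>v x t))"
    and controller_output: "\<And>t. t \<ge> 0 \<Longrightarrow> lam t = Hbar *\<^sub>v \<eta> t - B\<^sup>T *\<^sub>v x t"
  shows "bounded_traj ((n - 1) * p) \<eta> \<and>
         bounded_traj n (\<lambda>t. x t - drift n P w t \<cdot>\<^sub>v ones n) \<and>
         (bounded (drift n P w ` {0..}) \<longrightarrow> bounded_traj n x) \<and>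
         (\<exists>c'. converges_to_traj n x (\<lambda>t. (c' + drift n P w t) \<cdot>\<^sub>v ones n))"
proof -
  interpret net: incidence_graph G n m pos neg
    by (rule incidence_graph.intro) fact+
  define N where "N = n - 1"
  have Bc: "B \<in> carrier_mat n m" unfolding B by (rule incidence_mat_carrier)
  then have BT: "B\<^sup>T \<in> carrier_mat m n" by simp
  have Sdc: "Sd \<in> carrier_mat p p"
    unfolding Sd p using Sdj by (rule diag_block_mat_carrier)
  have \<Gamma>dc: "\<Gamma>d \<in> carrier_mat q p"
    using diag_block_mat_carrier[OF \<Gamma>dj] unfolding \<Gamma>d p by simp
  have Pc: "P \<in> carrier_mat n p" unfolding P using P0 \<Gamma>dc by (rule mult_carrier_mat)
  have Sd_skew: "Sd\<^sup>T = - Sd"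
    unfolding Sd
  proof (rule diag_block_mat_skew)
    fix A assume "A \<in> set (map Sdj [0..<q])"
    then obtain j where "j < q" "A = Sdj j" by auto
    then show "square_mat A \<and> A\<^sup>T = - A" using Sdj[of j] skew[of j] by simp
  qed
  note M_props = net.M_mat_props[OF Ba[unfolded B] Pc, folded B, folded M]
  have Hc: "Hbar \<in> carrier_mat m (N * p)"
    unfolding Hbar N_def by (rule H_bar_carrier[OF M_props(1) net.edges_ge])
  have H_rep: "Hbar *\<^sub>v replicate_vec N v = M *\<^sub>v v" if "v \<in> carrier_vec p" for v
    unfolding Hbar N_def by (rule H_bar_mult_replicate_vec[OF M_props(1) net.edges_ge M_props(2) that])
  have Sbc: "Sbar \<in> carrier_mat (N * p) (N * p)"
    unfolding Sbar N_def by (rule S_bar_carrier[OF Sdc])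
  have Sb_skew: "Sbar\<^sup>T = - Sbar" unfolding Sbar by (rule S_bar_skew[OF Sdc Sd_skew])
  define F where "F = B * Hbar"
  have Fc: "F \<in> carrier_mat n (N * p)" unfolding F_def by (rule mult_carrier_mat[OF Bc Hc])
  have wc: "w t \<in> carrier_vec p" and xc: "x t \<in> carrier_vec n" and \<eta>c: "\<eta> t \<in> carrier_vec (N * p)"
    if "t \<ge> 0" for t
    using solves_odeD(1)[OF exosystem that] solves_odeD(1)[OF plant that]
      solves_odeD(1)[OF controller_state that] by (simp_all add: N_def)
  have Sdw: "Sd *\<^sub>v w t \<in> carrier_vec p" if "t \<ge> 0" for t
    using Sdc wc[OF that] by simp
  define \<xi> where "\<xi> = (\<lambda>t. x t - drift n P w t \<cdot>\<^sub>v ones n)"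
  define \<zeta> where "\<zeta> = (\<lambda>t. \<eta> t - replicate_vec N (w t))"
  have rc: "replicate_vec N (w t) \<in> carrier_vec (N * p)" if "t \<ge> 0" for t
    by (rule replicate_vec_carrier[OF wc[OF that]])
  have dc: "drift n P w t \<cdot>\<^sub>v ones n \<in> carrier_vec n" for t by (simp add: ones_carrier)
  \<comment> \<open>The controller measures only differences across edges, so it cannot see the
    common drift.\<close>
  have BT\<xi>: "B\<^sup>T *\<^sub>v \<xi> t = B\<^sup>T *\<^sub>v x t" if "t \<ge> 0" for t
    unfolding \<xi>_def mult_minus_distrib_mat_vec[OF BT xc[OF that] dc]
      mult_mat_vec[OF BT ones_carrier] net.incidence_transpose_mult_ones[folded B]
    using Bc xc[OF that] by (intro eq_vecI) auto
  have \<xi>: "solves_ode n \<xi> (\<lambda>t. F *\<^sub>v \<zeta> t - B *\<^sub>v (B\<^sup>T *\<^sub>v \<xi> t))"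
  proof (rule solves_ode_cong)
    \<comment> \<open>Differentiation gives this raw right-hand side; the rest of the block rewrites
      it at nonnegative times into dissipative form.\<close>
    show "solves_ode n \<xi> (\<lambda>t. (B *\<^sub>v lam t + P0 *\<^sub>v d t)
        - (ones n \<bullet> (P *\<^sub>v w t) / real n) \<cdot>\<^sub>v ones n)"
      unfolding \<xi>_def
      by (intro solves_ode_minus plant solves_ode_smult_ones
          drift_has_real_derivative[OF exosystem Sdw Pc]) (simp_all add: ones_carrier)
    fix t :: real assume t: "t \<ge> 0"
    define a b c k where "a = B *\<^sub>v (Hbar *\<^sub>v \<eta> t)" and "b = B *\<^sub>v (B\<^sup>T *\<^sub>v x t)"
      and "c = P *\<^sub>v w t" and "k = (ones n \<bullet> (P *\<^sub>v w t) / real n) \<cdot>\<^sub>v ones n"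
    have H\<eta>: "Hbar *\<^sub>v \<eta> t \<in> carrier_vec m" and BTx: "B\<^sup>T *\<^sub>v x t \<in> carrier_vec m"
      and Mw: "M *\<^sub>v w t \<in> carrier_vec m"
      using mult_mat_vec_carrier[OF Hc \<eta>c[OF t]] mult_mat_vec_carrier[OF BT xc[OF t]]
        mult_mat_vec_carrier[OF M_props(1) wc[OF t]] .
    have carriers: "a \<in> carrier_vec n" "b \<in> carrier_vec n" "c \<in> carrier_vec n" "k \<in> carrier_vec n"
      using mult_mat_vec_carrier[OF Bc H\<eta>] mult_mat_vec_carrier[OF Bc BTx]
        mult_mat_vec_carrier[OF Pc wc[OF t]] smult_carrier_vec ones_carrier
      unfolding a_def b_def c_def k_def by blast+
    have "B *\<^sub>v lam t = a - b"
      unfolding controller_output[OF t] a_def b_def by (rule mult_minus_distrib_mat_vec[OF Bc H\<eta> BTx])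
    moreover have "P0 *\<^sub>v d t = c"
      unfolding disturbance[OF t] c_def P by (rule assoc_mult_mat_vec[OF P0 \<Gamma>dc wc[OF t], symmetric])
    \<comment> \<open>Subtracting the copies of \<open>w\<close> from \<open>\<eta>\<close>
      subtracts \<open>M *\<^sub>v w t\<close> from the flow, which \<open>B\<close> maps to
      \<open>k - c\<close>, the mean inflow minus the actual inflow.\<close>
    moreover have "F *\<^sub>v \<zeta> t = a - (k - c)"
    proof -
      have \<zeta>t: "\<zeta> t \<in> carrier_vec (N * p)" unfolding \<zeta>_def using \<eta>c[OF t] rc[OF t] by simp
      have "F *\<^sub>v \<zeta> t = B *\<^sub>v (Hbar *\<^sub>v \<zeta> t)"
        unfolding F_def by (rule assoc_mult_mat_vec[OF Bc Hc \<zeta>t])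
      also have "Hbar *\<^sub>v \<zeta> t = Hbar *\<^sub>v \<eta> t - M *\<^sub>v w t"
        unfolding \<zeta>_def mult_minus_distrib_mat_vec[OF Hc \<eta>c[OF t] rc[OF t]] H_rep[OF wc[OF t]] ..
      also have "B *\<^sub>v \<dots> = a - B *\<^sub>v (M *\<^sub>v w t)"
        unfolding a_def by (rule mult_minus_distrib_mat_vec[OF Bc H\<eta> Mw])
      finally show ?thesis unfolding M_props(3)[OF wc[OF t]] k_def c_def .
    qed
    \<comment> \<open>The disturbance \<open>c\<close> and the drift rate \<open>k\<close> are both
      absorbed into \<open>F *\<^sub>v \<zeta> t\<close>.\<close>
    moreover have "a - b + c - k = a - (k - c) - b"
      using carriers by (intro eq_vecI) auto
    ultimately show "(B *\<^sub>v lam t + P0 *\<^sub>v d t) - (ones n \<bullet> (P *\<^sub>v w t) / real n) \<cdot>\<^sub>v ones n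
        = F *\<^sub>v \<zeta> t - B *\<^sub>v (B\<^sup>T *\<^sub>v \<xi> t)"
      unfolding BT\<xi>[OF t] by (simp only: b_def[symmetric] k_def[symmetric])
  qed
  have \<zeta>: "solves_ode (N * p) \<zeta> (\<lambda>t. Sbar *\<^sub>v \<zeta> t - F\<^sup>T *\<^sub>v \<xi> t)"
  proof (rule solves_ode_cong)
    show "solves_ode (N * p) \<zeta> (\<lambda>t. (Sbar *\<^sub>v \<eta> t - Hbar\<^sup>T *\<^sub>v (B\<^sup>T *\<^sub>v x t))
        - replicate_vec N (Sd *\<^sub>v w t))"
      unfolding \<zeta>_def N_def
      by (intro solves_ode_minus controller_state solves_ode_replicate_vec exosystem
          replicate_vec_carrier Sdw)
    fix t :: real assume t: "t \<ge> 0"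
    have HT: "Hbar\<^sup>T \<in> carrier_mat (N * p) m" using Hc by simp
    \<comment> \<open>The feedback into \<open>\<eta>\<close> is the transpose of the map from
      \<open>\<eta>\<close> to the nodes; this makes the coupling lossless.\<close>
    have "F\<^sup>T = Hbar\<^sup>T * B\<^sup>T" unfolding F_def by (rule transpose_mult[OF Bc Hc])
    moreover have "\<xi> t \<in> carrier_vec n" using solves_odeD(1)[OF \<xi> t] .
    ultimately have FT: "F\<^sup>T *\<^sub>v \<xi> t = Hbar\<^sup>T *\<^sub>v (B\<^sup>T *\<^sub>v x t)"
      using assoc_mult_mat_vec[OF HT BT] BT\<xi>[OF t] by simp
    have S\<zeta>: "Sbar *\<^sub>v \<zeta> t = Sbar *\<^sub>v \<eta> t - replicate_vec N (Sd *\<^sub>v w t)"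
      unfolding \<zeta>_def mult_minus_distrib_mat_vec[OF Sbc \<eta>c[OF t] rc[OF t]]
      by (simp only: Sbar N_def S_bar_mult_replicate_vec[OF Sdc wc[OF t]])
    have "Hbar\<^sup>T *\<^sub>v (B\<^sup>T *\<^sub>v x t) \<in> carrier_vec (N * p)" "Sbar *\<^sub>v \<eta> t \<in> carrier_vec (N * p)"
      "replicate_vec N (Sd *\<^sub>v w t) \<in> carrier_vec (N * p)"
      using mult_mat_vec_carrier[OF HT mult_mat_vec_carrier[OF BT xc[OF t]]]
        mult_mat_vec_carrier[OF Sbc \<eta>c[OF t]] replicate_vec_carrier[OF Sdw[OF t]] .
    then show "(Sbar *\<^sub>v \<eta> t - Hbar\<^sup>T *\<^sub>v (B\<^sup>T *\<^sub>v x t)) - replicate_vec N (Sd *\<^sub>v w t)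
        = Sbar *\<^sub>v \<zeta> t - F\<^sup>T *\<^sub>v \<xi> t"
      unfolding FT S\<zeta> by (rule minus_vec_right_commute)
  qed
  note stable = dissipative_network[OF Bc Fc Sbc Sb_skew \<xi> \<zeta>]
  have \<xi>c: "\<xi> t \<in> carrier_vec n" if "t \<ge> 0" for t using solves_odeD(1)[OF \<xi> that] .
  have \<zeta>c: "\<zeta> t \<in> carrier_vec (N * p)" if "t \<ge> 0" for t using solves_odeD(1)[OF \<zeta> that] .
  have bounded_\<eta>: "bounded_traj ((n - 1) * p) \<eta>"
  proof -
    \<comment> \<open>As a skew flow \<open>w\<close> is bounded, so adding its copies back to the
      bounded \<open>\<zeta>\<close> bounds \<open>\<eta>\<close>.\<close>
    have "bounded_traj (N * p) (\<lambda>t. \<zeta> t + replicate_vec N (w t))"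
      by (intro bounded_traj_add stable(2) bounded_traj_replicate_vec rc wc
          skew_flow_bounded[OF exosystem Sdc Sd_skew])
    then show ?thesis
      unfolding N_def[symmetric]
    proof (rule bounded_traj_cong)
      fix t :: real and i assume "t \<ge> 0" "i < N * p"
      then show "(\<zeta> t + replicate_vec N (w t)) $ i = \<eta> t $ i"
        using rc[of t] \<eta>c[of t] by (simp add: \<zeta>_def)
    qed
  qed
  have x_index: "x t $ i = \<xi> t $ i + drift n P w t" if "t \<ge> 0" "i < n" for t i
    using that xc[of t] by (simp add: \<xi>_def ones_def)
  have bounded_x: "bounded_traj n x" if drift: "bounded (drift n P w ` {0..})"
  proof -
    have "bounded_traj n (\<lambda>t. drift n P w t \<cdot>\<^sub>v ones n)"
      unfolding bounded_traj_def using drift by (simp add: ones_def)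
    from bounded_traj_add[OF stable(1) this dc] show ?thesis
    proof (rule bounded_traj_cong)
      fix t :: real and i assume "t \<ge> 0" "i < n"
      then show "(\<xi> t + drift n P w t \<cdot>\<^sub>v ones n) $ i = x t $ i"
        using x_index[of t i] by (simp add: ones_def)
    qed
  qed
  \<comment> \<open>The derivative of \<open>\<xi>\<close> has the form
    \<open>B *\<^sub>v v\<close>, and the columns of \<open>B\<close> sum to zero.\<close>
  have total: "ones n \<bullet> \<xi> t = ones n \<bullet> \<xi> 0" if t: "t \<ge> 0" for t
  proof -
    have "((\<lambda>s. ones n \<bullet> \<xi> s) has_real_derivative 0) (at s within {0..})" if s: "s \<ge> 0" for s
    proof -
      define v where "v = Hbar *\<^sub>v \<zeta> s - B\<^sup>T *\<^sub>v \<xi> s"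
      have H\<zeta>: "Hbar *\<^sub>v \<zeta> s \<in> carrier_vec m" and BT\<xi>: "B\<^sup>T *\<^sub>v \<xi> s \<in> carrier_vec m"
        using mult_mat_vec_carrier[OF Hc \<zeta>c[OF s]] mult_mat_vec_carrier[OF BT \<xi>c[OF s]] .
      then have v: "v \<in> carrier_vec m" by (simp add: v_def)
      have "F *\<^sub>v \<zeta> s - B *\<^sub>v (B\<^sup>T *\<^sub>v \<xi> s) = B *\<^sub>v v"
        unfolding v_def F_def assoc_mult_mat_vec[OF Bc Hc \<zeta>c[OF s]]
        by (rule mult_minus_distrib_mat_vec[OF Bc H\<zeta> BT\<xi>, symmetric])
      moreover have "ones n \<bullet> (B *\<^sub>v v) = 0"
        using transpose_vec_mult_scalar[OF Bc v ones_carrier] v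
          net.incidence_transpose_mult_ones[folded B] by simp
      moreover have "B *\<^sub>v v \<in> carrier_vec n" by (rule mult_mat_vec_carrier[OF Bc v])
      ultimately show ?thesis
        using solves_ode_scalar_prod[OF solves_ode_const[OF ones_carrier] \<xi> s] \<xi>c[OF s] by simp
    qed
    then show ?thesis
      using mean_value_half_line[of "\<lambda>s. ones n \<bullet> \<xi> s" "\<lambda>_. 0" 0 t] t by (cases "t = 0") auto
  qed
  \<comment> \<open>The mean initial deviation; since the drift vanishes at time 0, this is the mean
    of the entries of \<open>x 0\<close>.\<close>
  define c' where "c' = ones n \<bullet> \<xi> 0 / n"
  have "converges_to_traj n x (\<lambda>t. (c' + drift n P w t) \<cdot>\<^sub>v ones n)"
    unfolding converges_to_traj_def
  proof (intro allI impI)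
    fix i assume i: "i < n"
    have "((\<lambda>t. \<xi> t $ i) \<longlongrightarrow> c') at_top"
      unfolding c'_def by (rule net.consensus[OF \<xi>c stable(3)[unfolded B] total i])
    then have "((\<lambda>t. \<xi> t $ i - c') \<longlongrightarrow> 0) at_top"
      by (simp add: LIM_zero_iff)
    moreover have "\<forall>\<^sub>F t in at_top. \<xi> t $ i - c' = x t $ i - ((c' + drift n P w t) \<cdot>\<^sub>v ones n) $ i"
      using eventually_ge_at_top[of "0 :: real"]
      by eventually_elim (use i x_index in \<open>simp add: ones_def\<close>)
    ultimately show "((\<lambda>t. x t $ i - ((c' + drift n P w t) \<cdot>\<^sub>v ones n) $ i) \<longlongrightarrow> 0) at_top"
      by (simp add: tendsto_cong)
  qed
  with bounded_\<eta> stable(1) bounded_x show ?thesis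
    unfolding \<xi>_def by blast
qed

end
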